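(* Fix $y\in\mathbb R$ and let $\pi$ be the probability measure on $(0,\infty)\times\mathbb R\times\mathbb R$ whose density at $(u,v,w)$ with respect to Lebesgue measure is proportional to $$\exp\left[-\tfrac12\left(1+(y-w)^2\right)u\right]\exp\left[-\tfrac12(w-v)^2\right].$$ Then the blocked Gibbs sampler with operator $P_{E_U}P_{E_V\cap E_W}$ on $L^2(\pi)$ has a spectral gap, i.e. $r\left(P_{E_U}P_{E_V\cap E_W}-\Pi\right)<1$.
   Context: The measure $\pi$ is the posterior distribution of $(U,V,W)$ given $Y=y$ in the model $Y=W+N_1/\sqrt U$, $W=V+N_2$, with $N_1,N_2\sim N(0,1)$, $U\sim\Gamma(1/2,1/2)$ (density proportional to $u^{-1/2}e^{-u/2}$, $u>0$), a flat prior on $V$, and $N_1,N_2,U,V$ mutually independent; the displayed function is integrable, so $\pi$ is a well-defined probability measure. Let $(U,V,W)\sim\pi$. $L^2(\pi)$ is the complex Hilbert space of square-integrable functions on $(0,\infty)\times\mathbb R\times\mathbb R$; $E_U,E_V,E_W$ are the closed subspaces of functions that are constant with respect to the $u$-, $v$-, $w$-coordinate; $E_V\cap E_W$ is the subspace of functions depending only on $u$. $P_S$ is the orthogonal projection onto $S$: $P_{E_U}f=\mathbb E[f(U,V,W)\mid V,W]$ and $P_{E_V\cap E_W}f=\mathbb E[f(U,V,W)\mid U]$. $\Pi f$ is the constant function $\int f\,d\pi$, and $r(T)$ is the spectral radius of a bounded operator $T$. *)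

theory Defs
  imports "HOL-Analysis.Analysis"
begin

text \<open>
  Elements of the complex Hilbert space \<open>L\<^sup>2(M)\<close> are represented by square-integrable
  functions, two of which stand for the same element iff they agree \<open>M\<close>-almost everywhere.
  Accordingly, all identities between elements and between operators are stated almost
  everywhere, and subspaces are closed under almost everywhere equality.
\<close>

definition L2 :: "'a measure \<Rightarrow> ('a \<Rightarrow> complex) set" where
  "L2 M = {f \<in> borel_measurable M. integrable M (\<lambda>x. (cmod (f x))\<^sup>2)}"

definition l2_inner :: "'a measure \<Rightarrow> ('a \<Rightarrow> complex) \<Rightarrow> ('a \<Rightarrow> complex) \<Rightarrow> complex" where
  "l2_inner M f g = (\<integral>x. f x * cnj (g x) \<partial>M)"

definition l2_norm :: "'a measure \<Rightarrow> ('a \<Rightarrow> complex) \<Rightarrow> real" where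
  "l2_norm M f = sqrt (\<integral>x. (cmod (f x))\<^sup>2 \<partial>M)"

text \<open>
  Linearity and boundedness together imply that the operator respects almost everywhere
  equality, so it is a bounded operator on the space of equivalence classes.
\<close>

definition l2_bounded_operator ::
    "'a measure \<Rightarrow> (('a \<Rightarrow> complex) \<Rightarrow> ('a \<Rightarrow> complex)) \<Rightarrow> bool" where
  "l2_bounded_operator M T \<longleftrightarrow>
     (\<forall>f\<in>L2 M. T f \<in> L2 M) \<and>
     (\<forall>f\<in>L2 M. \<forall>g\<in>L2 M. AE x in M. T (\<lambda>x. f x + g x) x = T f x + T g x) \<and>
     (\<forall>c. \<forall>f\<in>L2 M. AE x in M. T (\<lambda>x. c * f x) x = c * T f x) \<and>
     (\<exists>C. \<forall>f\<in>L2 M. l2_norm M (T f) \<le> C * l2_norm M f)"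

text \<open>
  A scalar \<open>z\<close> belongs to the spectrum iff \<open>z I - T\<close> has no bounded two-sided inverse.
\<close>

definition l2_spectrum ::
    "'a measure \<Rightarrow> (('a \<Rightarrow> complex) \<Rightarrow> ('a \<Rightarrow> complex)) \<Rightarrow> complex set" where
  "l2_spectrum M T =
     {z. \<not> (\<exists>R. l2_bounded_operator M R \<and>
              (\<forall>f\<in>L2 M. AE x in M. R (\<lambda>t. z * f t - T f t) x = f x) \<and>
              (\<forall>f\<in>L2 M. AE x in M. z * R f x - T (R f) x = f x))}"

text \<open>
  The supremum is taken in \<^typ>\<open>ennreal\<close>, where it exists without side conditions.
\<close>

definition l2_spectral_radius ::
    "'a measure \<Rightarrow> (('a \<Rightarrow> complex) \<Rightarrow> ('a \<Rightarrow> complex)) \<Rightarrow> ennreal" where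
  "l2_spectral_radius M T = (SUP z\<in>l2_spectrum M T. ennreal (cmod z))"

text \<open>
  The orthogonal projection onto a closed subspace \<open>S\<close>; the defining property determines
  the value up to almost everywhere equality.
\<close>

definition l2_proj ::
    "'a measure \<Rightarrow> ('a \<Rightarrow> complex) set \<Rightarrow> ('a \<Rightarrow> complex) \<Rightarrow> ('a \<Rightarrow> complex)" where
  "l2_proj M S f = (SOME g. g \<in> S \<and> (\<forall>h\<in>S. l2_inner M (\<lambda>x. f x - g x) h = 0))"

definition mean_op :: "'a measure \<Rightarrow> ('a \<Rightarrow> complex) \<Rightarrow> ('a \<Rightarrow> complex)" where
  "mean_op M f = (\<lambda>_. \<integral>x. f x \<partial>M)"

text \<open>
  The classes with a representative that is constant in the \<open>u\<close>-, \<open>v\<close>-, \<open>w\<close>-coordinate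
  of a point \<open>(u, v, w)\<close>.
\<close>

definition E_U :: "(real \<times> real \<times> real) measure \<Rightarrow> (real \<times> real \<times> real \<Rightarrow> complex) set" where
  "E_U M = {f \<in> L2 M. \<exists>g\<in>L2 M. (\<forall>u u' v w. g (u, v, w) = g (u', v, w)) \<and> (AE x in M. f x = g x)}"

definition E_V :: "(real \<times> real \<times> real) measure \<Rightarrow> (real \<times> real \<times> real \<Rightarrow> complex) set" where
  "E_V M = {f \<in> L2 M. \<exists>g\<in>L2 M. (\<forall>u v v' w. g (u, v, w) = g (u, v', w)) \<and> (AE x in M. f x = g x)}"

definition E_W :: "(real \<times> real \<times> real) measure \<Rightarrow> (real \<times> real \<times> real \<Rightarrow> complex) set" where
  "E_W M = {f \<in> L2 M. \<exists>g\<in>L2 M. (\<forall>u v w w'. g (u, v, w) = g (u, v, w')) \<and> (AE x in M. f x = g x)}"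

text \<open>
  The unnormalised density is extended by zero to \<open>u \<le> 0\<close>, so that the probability measure
  lives on all of \<open>\<real>\<^sup>3\<close> but is concentrated on \<open>u > 0\<close>; values of functions at \<open>u \<le> 0\<close> are
  therefore irrelevant in \<open>L\<^sup>2\<close>.
\<close>

definition posterior_kernel :: "real \<Rightarrow> real \<times> real \<times> real \<Rightarrow> real" where
  "posterior_kernel y = (\<lambda>(u, v, w).
     if 0 < u then exp (- (1/2) * (1 + (y - w)\<^sup>2) * u) * exp (- (1/2) * (w - v)\<^sup>2) else 0)"

definition posterior :: "real \<Rightarrow> (real \<times> real \<times> real) measure" where
  "posterior y = density lborel
     (\<lambda>x. ennreal (posterior_kernel y x) / (\<integral>\<^sup>+z. ennreal (posterior_kernel y z) \<partial>lborel))"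

definition blocked_gibbs ::
    "(real \<times> real \<times> real) measure \<Rightarrow>
     (real \<times> real \<times> real \<Rightarrow> complex) \<Rightarrow> (real \<times> real \<times> real \<Rightarrow> complex)" where
  "blocked_gibbs M = l2_proj M (E_U M) \<circ> l2_proj M (E_V M \<inter> E_W M)"

end

theory Submission
  imports Defs "HOL-Probability.Probability"
begin

text \<open>
  Since constants lie in both subspaces and \<open>\<parallel>g - P g\<parallel>\<^sup>2 = \<parallel>g\<parallel>\<^sup>2 - \<parallel>P g\<parallel>\<^sup>2\<close> for a projection \<open>P\<close>, the operator has
  norm below 1 as soon as every function \<open>g\<close> of \<open>u\<close> satisfies
  \<open>\<parallel>g - c\<parallel>\<^sup>2 \<le> K \<parallel>g - h\<parallel>\<^sup>2\<close> for all functions \<open>h\<close> of \<open>(v, w)\<close> and some constant \<open>c\<close> depending on \<open>g\<close> and \<open>h\<close>.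

  This Poincare inequality comes from Lyapunov functions: for \<open>G = g - c\<close>, \<open>H = h - c\<close> and positive \<open>A(u)\<close>, \<open>B(w)\<close>,
  \<open>\<bar>G\<bar>\<^sup>2 + \<bar>H\<bar>\<^sup>2 \<le> \<bar>G - H\<bar>\<^sup>2 + \<bar>G\<bar>\<^sup>2 B / A + \<bar>H\<bar>\<^sup>2 A / B\<close>.
  With \<open>B = (1 + (w - y)\<^sup>2)\<^bsup>1/4\<^esup>\<close> and \<open>A = 1 + (2 / (\<pi> u))\<^bsup>1/4\<^esup>\<close> one has \<open>E[B | u] \<le> A\<close> and
  \<open>E[A | w] \<le> 1 + 19/20 B\<close>, so that \<open>\<parallel>H\<parallel>\<^sup>2\<close> is controlled by \<open>\<parallel>G - H\<parallel>\<^sup>2\<close> and the integral of \<open>\<bar>H\<bar>\<^sup>2\<close> over a bounded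
  range of \<open>w\<close>. There the density is bounded below on \<open>u \<in> [1, 2]\<close>, and some \<open>c = g(u\<^sub>0)\<close> works.
\<close>

subsection \<open>The space of square-integrable functions\<close>

lemma L2_measurable: "f \<in> L2 M \<Longrightarrow> f \<in> borel_measurable M"
  by (simp add: L2_def)

lemma L2_integrable_square: "f \<in> L2 M \<Longrightarrow> integrable M (\<lambda>x. (cmod (f x))\<^sup>2)"
  by (simp add: L2_def)

lemma cmod_add_square_le: "(cmod (a + b))\<^sup>2 \<le> 2 * (cmod a)\<^sup>2 + 2 * (cmod b)\<^sup>2"
proof -
  have "(cmod (a + b))\<^sup>2 \<le> (cmod a + cmod b)\<^sup>2"
    by (intro power_mono norm_triangle_ineq) simp
  also have "\<dots> \<le> 2 * (cmod a)\<^sup>2 + 2 * (cmod b)\<^sup>2"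
    using sum_squares_bound[of "cmod a" "cmod b"] by (simp add: power2_sum)
  finally show ?thesis .
qed

lemma L2_add:
  assumes "f \<in> L2 M" "g \<in> L2 M"
  shows "(\<lambda>x. f x + g x) \<in> L2 M"
proof -
  note [measurable] = assms[THEN L2_measurable]
  have "integrable M (\<lambda>x. (cmod (f x + g x))\<^sup>2)"
    by (rule Bochner_Integration.integrable_bound[of _ "\<lambda>x. 2 * (cmod (f x))\<^sup>2 + 2 * (cmod (g x))\<^sup>2"])
      (use assms[THEN L2_integrable_square] cmod_add_square_le in auto)
  then show ?thesis by (simp add: L2_def)
qed

lemma L2_scale:
  assumes "f \<in> L2 M"
  shows "(\<lambda>x. c * f x) \<in> L2 M"
  using assms by (auto simp: L2_def norm_mult power_mult_distrib)

lemma L2_diff: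
  assumes "f \<in> L2 M" "g \<in> L2 M"
  shows "(\<lambda>x. f x - g x) \<in> L2 M"
  using L2_add[OF assms(1) L2_scale[OF assms(2), of "-1"]] by simp

lemma (in finite_measure) L2_const: "(\<lambda>_. c) \<in> L2 M"
  by (simp add: L2_def)

lemma L2_cong_AE:
  assumes "f \<in> L2 M" "g \<in> borel_measurable M" "AE x in M. f x = g x"
  shows "g \<in> L2 M"
proof -
  note [measurable] = L2_measurable[OF assms(1)] assms(2)
  have "integrable M (\<lambda>x. (cmod (g x))\<^sup>2)"
    by (rule Bochner_Integration.integrable_cong_AE_imp[OF L2_integrable_square[OF assms(1)]])
      (use assms(3) in auto)
  then show ?thesis using assms(2) by (simp add: L2_def)
qed

lemma L2_iff_nn_integral:
  "f \<in> L2 M \<longleftrightarrow> f \<in> borel_measurable M \<and> (\<integral>\<^sup>+x. ennreal ((cmod (f x))\<^sup>2) \<partial>M) < \<infinity>"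
  by (auto simp: L2_def integrable_iff_bounded)

lemma l2_norm_nonneg [simp]: "0 \<le> l2_norm M f"
  by (simp add: l2_norm_def)

lemma l2_norm_square: "(l2_norm M f)\<^sup>2 = (\<integral>x. (cmod (f x))\<^sup>2 \<partial>M)"
  by (simp add: l2_norm_def)

lemma nn_integral_L2:
  assumes "f \<in> L2 M"
  shows "(\<integral>\<^sup>+x. ennreal ((cmod (f x))\<^sup>2) \<partial>M) = ennreal ((l2_norm M f)\<^sup>2)"
  using L2_integrable_square[OF assms] by (simp add: l2_norm_square nn_integral_eq_integral)

lemma borel_measurable_cnj [measurable (raw)]:
  "f \<in> borel_measurable M \<Longrightarrow> (\<lambda>x. cnj (f x)) \<in> borel_measurable M"
  by (rule borel_measurable_continuous_on) (auto intro: continuous_intros)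

lemma L2_integrable_mult:
  assumes "f \<in> L2 M" "g \<in> L2 M"
  shows "integrable M (\<lambda>x. f x * cnj (g x))"
proof -
  note [measurable] = assms[THEN L2_measurable]
  show ?thesis
  proof (rule Bochner_Integration.integrable_bound[of _ "\<lambda>x. (cmod (f x))\<^sup>2 + (cmod (g x))\<^sup>2"])
    show "AE x in M. cmod (f x * cnj (g x)) \<le> norm ((cmod (f x))\<^sup>2 + (cmod (g x))\<^sup>2)"
    proof (rule AE_I2)
      fix x
      have "2 * cmod (f x) * cmod (g x) \<le> (cmod (f x))\<^sup>2 + (cmod (g x))\<^sup>2"
        by (rule sum_squares_bound)
      moreover have "0 \<le> cmod (f x) * cmod (g x)" by simp
      ultimately have "cmod (f x) * cmod (g x) \<le> (cmod (f x))\<^sup>2 + (cmod (g x))\<^sup>2" by linarith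
      then show "cmod (f x * cnj (g x)) \<le> norm ((cmod (f x))\<^sup>2 + (cmod (g x))\<^sup>2)"
        by (simp add: norm_mult)
    qed
  qed (use assms[THEN L2_integrable_square] in auto)
qed

lemma (in finite_measure) L2_integrable: "f \<in> L2 M \<Longrightarrow> integrable M f"
  using L2_integrable_mult[OF _ L2_const[of 1]] by simp

lemma l2_norm_scale: "l2_norm M (\<lambda>x. c * f x) = cmod c * l2_norm M f"
  by (simp add: l2_norm_def norm_mult power_mult_distrib real_sqrt_mult)

lemma l2_norm_cong_AE:
  assumes "AE x in M. f x = g x" "f \<in> borel_measurable M" "g \<in> borel_measurable M"
  shows "l2_norm M f = l2_norm M g"
proof -
  note [measurable] = assms(2,3)
  show ?thesis unfolding l2_norm_def
    by (intro arg_cong[where f = sqrt] integral_cong_AE) (use assms(1) in auto)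
qed

lemma l2_norm_eq_0_AE:
  assumes "f \<in> L2 M" "l2_norm M f = 0"
  shows "AE x in M. f x = 0"
proof -
  have "(\<integral>x. (cmod (f x))\<^sup>2 \<partial>M) = 0"
    using assms(2) l2_norm_square[of M f] by simp
  then show ?thesis
    using L2_integrable_square[OF assms(1)] by (simp add: integral_nonneg_eq_0_iff_AE)
qed

lemma l2_norm_add_square_le:
  assumes "f \<in> L2 M" "g \<in> L2 M"
  shows "(l2_norm M (\<lambda>x. f x + g x))\<^sup>2 \<le> 2 * (l2_norm M f)\<^sup>2 + 2 * (l2_norm M g)\<^sup>2"
proof -
  have "(\<integral>x. (cmod (f x + g x))\<^sup>2 \<partial>M) \<le> (\<integral>x. 2 * (cmod (f x))\<^sup>2 + 2 * (cmod (g x))\<^sup>2 \<partial>M)"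
    using assms[THEN L2_integrable_square] L2_integrable_square[OF L2_add[OF assms]]
    by (intro integral_mono) (auto intro: cmod_add_square_le)
  then show ?thesis
    using assms[THEN L2_integrable_square] by (simp add: l2_norm_square)
qed

subsection \<open>Neumann series\<close>

text \<open>Pointwise summation takes the place of completeness. The weighted sum
  \<open>\<Phi>\<close> of |F n|^2 / \<rho>^n has integral at most C^2 / (1 - \<rho>), so it is
  finite almost everywhere; where it equals t, the n-th term is at most sqrt t * (sqrt \<rho>)^n and
  the series converges absolutely.\<close>

lemma L2_suminf_geometric:
  fixes F :: "nat \<Rightarrow> 'a \<Rightarrow> complex"
  assumes F: "\<And>n. F n \<in> L2 M" "\<And>n. l2_norm M (F n) \<le> C * \<rho> ^ n" and \<rho>: "0 < \<rho>" "\<rho> < 1"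
  shows "AE x in M. summable (\<lambda>n. F n x)"
    and "(\<lambda>x. \<Sum>n. F n x) \<in> L2 M"
    and "(l2_norm M (\<lambda>x. \<Sum>n. F n x))\<^sup>2 \<le> C\<^sup>2 / ((1 - \<rho>) * (1 - sqrt \<rho>)\<^sup>2)"
proof -
  note [measurable] = F(1)[THEN L2_measurable]
  define \<Phi> where "\<Phi> x = (\<Sum>n. ennreal ((cmod (F n x))\<^sup>2 / \<rho> ^ n))" for x
  have [measurable]: "\<Phi> \<in> borel_measurable M" unfolding \<Phi>_def by measurable
  have "(\<integral>\<^sup>+x. \<Phi> x \<partial>M) = (\<Sum>n. \<integral>\<^sup>+x. ennreal ((cmod (F n x))\<^sup>2 / \<rho> ^ n) \<partial>M)"
    unfolding \<Phi>_def by (rule nn_integral_suminf) measurable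
  also have "\<dots> \<le> (\<Sum>n. ennreal (C\<^sup>2 * \<rho> ^ n))"
  proof (intro suminf_le allI)
    fix n
    have "(\<integral>\<^sup>+x. ennreal ((cmod (F n x))\<^sup>2 / \<rho> ^ n) \<partial>M)
        = (\<integral>\<^sup>+x. ennreal (1 / \<rho> ^ n) * ennreal ((cmod (F n x))\<^sup>2) \<partial>M)"
      using \<rho> by (intro nn_integral_cong) (simp add: ennreal_mult[symmetric])
    also have "\<dots> = ennreal (1 / \<rho> ^ n) * ennreal ((l2_norm M (F n))\<^sup>2)"
      by (subst nn_integral_cmult) (auto simp: nn_integral_L2[OF F(1)])
    also have "\<dots> = ennreal ((l2_norm M (F n))\<^sup>2 / \<rho> ^ n)"
      using \<rho> by (simp add: ennreal_mult[symmetric])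
    also have "\<dots> \<le> ennreal (C\<^sup>2 * \<rho> ^ n)"
    proof (rule ennreal_leI)
      have "(l2_norm M (F n))\<^sup>2 \<le> (C * \<rho> ^ n)\<^sup>2" by (intro power_mono F) simp
      then show "(l2_norm M (F n))\<^sup>2 / \<rho> ^ n \<le> C\<^sup>2 * \<rho> ^ n"
        using \<rho> by (simp add: divide_le_eq power2_eq_square mult_ac)
    qed
    finally show "(\<integral>\<^sup>+x. ennreal ((cmod (F n x))\<^sup>2 / \<rho> ^ n) \<partial>M) \<le> ennreal (C\<^sup>2 * \<rho> ^ n)" .
  qed auto
  also have "\<dots> = ennreal (C\<^sup>2 / (1 - \<rho>))"
    using \<rho> sums_mult[OF geometric_sums[of \<rho>], of "C\<^sup>2"] by (intro suminf_ennreal_eq) auto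
  finally have int\<Phi>: "(\<integral>\<^sup>+x. \<Phi> x \<partial>M) \<le> ennreal (C\<^sup>2 / (1 - \<rho>))" .
  have fin: "AE x in M. \<Phi> x \<noteq> \<infinity>"
    by (rule nn_integral_PInf_AE) (use int\<Phi> in \<open>auto simp: top_unique\<close>)
  define s where "s = sqrt \<rho>"
  have s: "0 < s" "s < 1" "s\<^sup>2 = \<rho>" using \<rho> by (auto simp: s_def)
  have pointwise: "summable (\<lambda>n. F n x) \<and>
      ennreal ((cmod (\<Sum>n. F n x))\<^sup>2) \<le> ennreal (1 / (1 - s)\<^sup>2) * \<Phi> x" if "\<Phi> x \<noteq> \<infinity>" for x
  proof -
    define t where "t = enn2real (\<Phi> x)"
    have t: "0 \<le> t" "\<Phi> x = ennreal t" using that by (auto simp: t_def top.not_eq_extremum)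
    have bound: "cmod (F n x) \<le> sqrt t * s ^ n" for n
    proof -
      have "ennreal ((cmod (F n x))\<^sup>2 / \<rho> ^ n) \<le> \<Phi> x"
        unfolding \<Phi>_def using sum_le_suminf[of "\<lambda>n. ennreal ((cmod (F n x))\<^sup>2 / \<rho> ^ n)" "{n}"] by auto
      then have "(cmod (F n x))\<^sup>2 / \<rho> ^ n \<le> t" using t by simp
      moreover have sn2: "(s ^ n)\<^sup>2 = \<rho> ^ n" by (metis s(3) power_mult mult.commute)
      ultimately have "(cmod (F n x))\<^sup>2 \<le> (sqrt t * s ^ n)\<^sup>2"
        using \<rho> t sn2 by (simp add: power_mult_distrib divide_le_eq)
      then show ?thesis
        by (rule power2_le_imp_le) (use t s in simp)
    qed
    have sm: "summable (\<lambda>n. sqrt t * s ^ n)" using s by (intro summable_mult summable_geometric) simp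
    have sn: "summable (\<lambda>n. cmod (F n x))"
      by (rule summable_comparison_test'[OF sm]) (use bound in simp)
    have "cmod (\<Sum>n. F n x) \<le> (\<Sum>n. cmod (F n x))" by (rule summable_norm[OF sn])
    also have "\<dots> \<le> (\<Sum>n. sqrt t * s ^ n)" by (rule suminf_le[OF bound sn sm])
    also have "\<dots> = sqrt t / (1 - s)" using s by (simp add: suminf_mult suminf_geometric)
    finally have "(cmod (\<Sum>n. F n x))\<^sup>2 \<le> (sqrt t / (1 - s))\<^sup>2" by (rule power_mono) simp
    then have "ennreal ((cmod (\<Sum>n. F n x))\<^sup>2) \<le> ennreal (1 / (1 - s)\<^sup>2 * t)"
      using t by (intro ennreal_leI) (simp add: power_divide)
    then show ?thesis using summable_norm_cancel[OF sn] t
      by (simp add: ennreal_mult[symmetric])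
  qed
  show "AE x in M. summable (\<lambda>n. F n x)" using fin by eventually_elim (use pointwise in blast)
  have "(\<integral>\<^sup>+x. ennreal ((cmod (\<Sum>n. F n x))\<^sup>2) \<partial>M) \<le> (\<integral>\<^sup>+x. ennreal (1 / (1 - s)\<^sup>2) * \<Phi> x \<partial>M)"
    by (rule nn_integral_mono_AE) (use fin in eventually_elim, use pointwise in blast)
  also have "\<dots> = ennreal (1 / (1 - s)\<^sup>2) * (\<integral>\<^sup>+x. \<Phi> x \<partial>M)" by (rule nn_integral_cmult) measurable
  also have "\<dots> \<le> ennreal (1 / (1 - s)\<^sup>2) * ennreal (C\<^sup>2 / (1 - \<rho>))"
    by (rule mult_left_mono[OF int\<Phi>]) simp
  also have "\<dots> = ennreal (C\<^sup>2 / ((1 - \<rho>) * (1 - sqrt \<rho>)\<^sup>2))"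
    using \<rho> by (simp add: ennreal_mult[symmetric] s_def mult.commute)
  finally have le: "(\<integral>\<^sup>+x. ennreal ((cmod (\<Sum>n. F n x))\<^sup>2) \<partial>M) \<le> ennreal (C\<^sup>2 / ((1 - \<rho>) * (1 - sqrt \<rho>)\<^sup>2))" .
  then show mem: "(\<lambda>x. \<Sum>n. F n x) \<in> L2 M"
    unfolding L2_iff_nn_integral infinity_ennreal_def
    using le_less_trans[OF le ennreal_less_top] by (intro conjI) measurable
  show "(l2_norm M (\<lambda>x. \<Sum>n. F n x))\<^sup>2 \<le> C\<^sup>2 / ((1 - \<rho>) * (1 - sqrt \<rho>)\<^sup>2)"
    using le \<rho> by (simp add: nn_integral_L2[OF mem])
qed

text \<open>The inverse is the Neumann series of T^n f / z^(n+1), with ratio r / |z| < 1.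
  \<open>T\<close> is linear only up to null sets, so every identity holds almost everywhere. The
  left inverse is an index shift; for the right inverse, moving \<open>T\<close> through the sum is
  avoided by showing that the defect \<open>G\<close> vanishes.\<close>

lemma not_in_l2_spectrum:
  fixes T :: "('a \<Rightarrow> complex) \<Rightarrow> ('a \<Rightarrow> complex)"
  assumes T: "\<And>f. f \<in> L2 M \<Longrightarrow> T f \<in> L2 M"
    and add: "\<And>f g. f \<in> L2 M \<Longrightarrow> g \<in> L2 M \<Longrightarrow> AE x in M. T (\<lambda>x. f x + g x) x = T f x + T g x"
    and scale: "\<And>c f. f \<in> L2 M \<Longrightarrow> AE x in M. T (\<lambda>x. c * f x) x = c * T f x"
    and bound: "\<And>f. f \<in> L2 M \<Longrightarrow> l2_norm M (T f) \<le> r * l2_norm M f"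
    and r: "0 < r" "r < cmod z"
  shows "z \<notin> l2_spectrum M T"
proof -
  have z: "z \<noteq> 0" using r by auto
  \<comment> \<open>Boundedness makes \<open>T\<close> respect almost everywhere equality: the
    difference has norm 0, hence so has its image.\<close>
  have cong: "AE x in M. T f x = T g x" if f: "f \<in> L2 M" and g: "g \<in> L2 M" and "AE x in M. f x = g x" for f g
  proof -
    let ?d = "\<lambda>x. f x + (-1) * g x"
    have g1: "(\<lambda>x. (-1) * g x) \<in> L2 M" by (rule L2_scale[OF g])
    have d: "?d \<in> L2 M" by (rule L2_add[OF f g1])
    have "l2_norm M ?d = l2_norm M (\<lambda>_. 0)"
      by (rule l2_norm_cong_AE) (use that(3) L2_measurable[OF d] in auto)
    then have "l2_norm M (T ?d) \<le> 0" using bound[OF d] by (simp add: l2_norm_def)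
    then have "l2_norm M (T ?d) = 0" by (intro antisym) simp_all
    then have "AE x in M. T ?d x = 0" by (rule l2_norm_eq_0_AE[OF T[OF d]])
    with add[OF f g1] scale[OF g, of "-1"] show ?thesis
      by eventually_elim simp
  qed
  define P where "P n = T ^^ n" for n
  have PSuc: "P (Suc n) f = T (P n f)" for n f by (simp add: P_def)
  have PSuc': "P (Suc n) f = P n (T f)" for n f unfolding P_def by (simp only: funpow_Suc_right o_apply)
  have P0: "P 0 f = f" for f by (simp add: P_def)
  have P: "P n f \<in> L2 M" if "f \<in> L2 M" for n f
    by (induction n) (use that T in \<open>auto simp: P0 PSuc\<close>)
  have Padd: "AE x in M. P n (\<lambda>x. f x + g x) x = P n f x + P n g x" if "f \<in> L2 M" "g \<in> L2 M" for n f g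
  proof (induction n)
    case (Suc n)
    have "AE x in M. T (P n (\<lambda>x. f x + g x)) x = T (\<lambda>x. P n f x + P n g x) x"
      by (rule cong) (use that Suc in \<open>auto intro: P L2_add\<close>)
    with add[OF P[OF that(1)] P[OF that(2)]] show ?case
      unfolding PSuc by eventually_elim auto
  qed (simp add: P0)
  have Pscale: "AE x in M. P n (\<lambda>x. c * f x) x = c * P n f x" if "f \<in> L2 M" for n f c
  proof (induction n)
    case (Suc n)
    have "AE x in M. T (P n (\<lambda>x. c * f x)) x = T (\<lambda>x. c * P n f x) x"
      by (rule cong) (use that Suc in \<open>auto intro: P L2_scale\<close>)
    with scale[OF P[OF that]] show ?case
      unfolding PSuc by eventually_elim auto
  qed (simp add: P0)
  have Pnorm: "l2_norm M (P n f) \<le> r ^ n * l2_norm M f" if "f \<in> L2 M" for n f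
  proof (induction n)
    case (Suc n)
    have "l2_norm M (T (P n f)) \<le> r * l2_norm M (P n f)" by (rule bound[OF P[OF that]])
    also have "\<dots> \<le> r * (r ^ n * l2_norm M f)" using Suc r by (intro mult_left_mono) auto
    finally show ?case by (simp add: PSuc mult_ac)
  qed (simp add: P0)
  define R where "R f x = (\<Sum>n. (1 / z ^ Suc n) * P n f x)" for f x
  define \<rho> where "\<rho> = r / cmod z"
  have \<rho>: "0 < \<rho>" "\<rho> < 1" using r z by (auto simp: \<rho>_def divide_less_eq)
  have summand: "(\<lambda>x. (1 / z ^ Suc n) * P n f x) \<in> L2 M" if "f \<in> L2 M" for n f
    by (rule L2_scale[OF P[OF that]])
  have termnorm: "l2_norm M (\<lambda>x. (1 / z ^ Suc n) * P n f x) \<le> (l2_norm M f / cmod z) * \<rho> ^ n"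
    if "f \<in> L2 M" for n f
  proof -
    have "l2_norm M (\<lambda>x. (1 / z ^ Suc n) * P n f x) = l2_norm M (P n f) / cmod z ^ Suc n"
      unfolding l2_norm_scale by (simp add: norm_divide norm_mult norm_power)
    also have "\<dots> \<le> r ^ n * l2_norm M f / cmod z ^ Suc n"
      by (intro divide_right_mono Pnorm that) simp
    finally show ?thesis by (simp add: \<rho>_def power_divide mult_ac)
  qed
  note series = L2_suminf_geometric[of "\<lambda>n x. (1 / z ^ Suc n) * P n f x" for f, OF summand termnorm \<rho>]
  \<comment> \<open>Square root of the constant in the series bound, with \<open>C\<close> equal to
    the norm of f over |z|.\<close>
  define K where "K = 1 / (cmod z * sqrt ((1 - \<rho>) * (1 - sqrt \<rho>)\<^sup>2))"
  have summ: "AE x in M. summable (\<lambda>n. (1 / z ^ Suc n) * P n f x)" if "f \<in> L2 M" for f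
    using series(1)[OF that that] .
  have R: "R f \<in> L2 M" if "f \<in> L2 M" for f
    using series(2)[OF that that] unfolding R_def .
  have Rnorm: "l2_norm M (R f) \<le> K * l2_norm M f" if "f \<in> L2 M" for f
  proof (rule power2_le_imp_le)
    have "(l2_norm M (R f))\<^sup>2 \<le> (l2_norm M f / cmod z)\<^sup>2 / ((1 - \<rho>) * (1 - sqrt \<rho>)\<^sup>2)"
      using series(3)[OF that that] unfolding R_def .
    also have "\<dots> = (K * l2_norm M f)\<^sup>2"
      using \<rho> by (simp add: K_def power_mult_distrib power_divide)
    finally show "(l2_norm M (R f))\<^sup>2 \<le> (K * l2_norm M f)\<^sup>2" .
    show "0 \<le> K * l2_norm M f" using \<rho> by (simp add: K_def)
  qed
  have Radd: "AE x in M. R (\<lambda>x. f x + g x) x = R f x + R g x" if fg: "f \<in> L2 M" "g \<in> L2 M" for f g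
  proof -
    \<comment> \<open>One null set serves all powers, since there are countably many of
      them.\<close>
    have "AE x in M. \<forall>n. P n (\<lambda>x. f x + g x) x = P n f x + P n g x"
      using Padd[OF fg] by (simp add: AE_all_countable)
    with summ[OF fg(1)] summ[OF fg(2)] show ?thesis
    proof eventually_elim
      case (elim x)
      show ?case unfolding R_def using elim(3)
        by (simp only: distrib_left suminf_add[OF elim(1,2)])
    qed
  qed
  have Rscale: "AE x in M. R (\<lambda>x. c * f x) x = c * R f x" if f: "f \<in> L2 M" for f c
  proof -
    have "AE x in M. \<forall>n. P n (\<lambda>x. c * f x) x = c * P n f x"
      using Pscale[OF f] by (simp add: AE_all_countable)
    with summ[OF f] show ?thesis
    proof eventually_elim
      case (elim x)
      have "R (\<lambda>x. c * f x) x = (\<Sum>n. c * ((1 / z ^ Suc n) * P n f x))"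
        unfolding R_def using elim(2) by (simp only: mult.left_commute)
      also have "\<dots> = c * R f x" unfolding R_def by (rule suminf_mult[OF elim(1)])
      finally show ?case .
    qed
  qed
  \<comment> \<open>The series for \<open>T f\<close> is z times the series for f without its first
    term.\<close>
  have step: "AE x in M. z * R f x = f x + R (T f) x" if f: "f \<in> L2 M" for f
    using summ[OF f]
  proof eventually_elim
    case (elim x)
    have "R (T f) x = (\<Sum>n. z * ((1 / z ^ Suc (Suc n)) * P (Suc n) f x))"
      unfolding R_def PSuc' using z by simp
    also have "\<dots> = z * (\<Sum>n. (1 / z ^ Suc (Suc n)) * P (Suc n) f x)"
      by (rule suminf_mult) (use elim in \<open>subst summable_Suc_iff\<close>)
    also have "\<dots> = z * (R f x - 1 / z * f x)"
      unfolding R_def using suminf_split_head[OF elim] by (simp add: P0)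
    finally show ?case using z by (simp add: algebra_simps)
  qed
  \<comment> \<open>The defect of \<open>R\<close> as a right inverse.\<close>
  define G where "G f x = z * R f x - T (R f) x - f x" for f x
  have GL2: "G f \<in> L2 M" if "f \<in> L2 M" for f
    unfolding G_def by (intro L2_diff L2_scale T R that)
  \<comment> \<open>Two applications of |a + b|^2 \<le> 2 |a|^2 + 2 |b|^2 give this crude constant;
    the geometric decay below absorbs it.\<close>
  define K' where "K' = sqrt (2 * (2 * (cmod z * K)\<^sup>2 + 2 * (r * K)\<^sup>2) + 2)"
  have Gnorm: "l2_norm M (G f) \<le> K' * l2_norm M f" if f: "f \<in> L2 M" for f
  proof (rule power2_le_imp_le)
    have 1: "(\<lambda>x. z * R f x) \<in> L2 M" "(\<lambda>x. (-1) * T (R f) x) \<in> L2 M" "(\<lambda>x. (-1) * f x) \<in> L2 M"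
      by (intro L2_scale T R f)+
    have "G f = (\<lambda>x. (z * R f x + (-1) * T (R f) x) + (-1) * f x)" by (auto simp: G_def fun_eq_iff)
    then have "(l2_norm M (G f))\<^sup>2 \<le> 2 * (l2_norm M (\<lambda>x. z * R f x + (-1) * T (R f) x))\<^sup>2 + 2 * (l2_norm M f)\<^sup>2"
      using l2_norm_add_square_le[OF L2_add[OF 1(1,2)] 1(3)] unfolding l2_norm_scale by simp
    moreover have "(l2_norm M (\<lambda>x. z * R f x + (-1) * T (R f) x))\<^sup>2
        \<le> 2 * (cmod z * l2_norm M (R f))\<^sup>2 + 2 * (l2_norm M (T (R f)))\<^sup>2"
      using l2_norm_add_square_le[OF 1(1,2)] unfolding l2_norm_scale by simp
    moreover have "(l2_norm M (T (R f)))\<^sup>2 \<le> (r * (K * l2_norm M f))\<^sup>2"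
      using bound[OF R[OF f]] Rnorm[OF f] r
      by (intro power_mono) (meson mult_left_mono less_imp_le order_trans, simp)
    moreover have "(cmod z * l2_norm M (R f))\<^sup>2 \<le> (cmod z * (K * l2_norm M f))\<^sup>2"
      by (intro power_mono mult_left_mono Rnorm[OF f]) simp_all
    ultimately have "(l2_norm M (G f))\<^sup>2 \<le> 2 * (2 * (cmod z * (K * l2_norm M f))\<^sup>2 + 2 * (r * (K * l2_norm M f))\<^sup>2)
        + 2 * (l2_norm M f)\<^sup>2"
      by argo
    also have "\<dots> = (K' * l2_norm M f)\<^sup>2"
      by (simp add: K'_def power_mult_distrib algebra_simps)
    finally show "(l2_norm M (G f))\<^sup>2 \<le> (K' * l2_norm M f)\<^sup>2" .
  qed (simp add: K'_def)
  \<comment> \<open>Expanding z R f by \<open>step\<close>, once directly and once under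
    \<open>T\<close>, turns the defect of f into that of \<open>T f\<close>. Each iteration then
    gains a factor \<open>\<rho>\<close> = r / |z|.\<close>
  have Gstep: "AE x in M. z * G f x = G (T f) x" if f: "f \<in> L2 M" for f
  proof -
    have "AE x in M. T (\<lambda>x. z * R f x) x = T (\<lambda>x. f x + R (T f) x) x"
      by (rule cong) (use step[OF f] in \<open>auto intro: L2_scale L2_add R T f\<close>)
    with scale[OF R[OF f], of z] add[OF f R[OF T[OF f]]] step[OF f] show ?thesis
    proof eventually_elim
      case (elim x)
      have "z * G f x = z * (z * R f x) - z * T (R f) x - z * f x" by (simp add: G_def algebra_simps)
      also have "\<dots> = z * (f x + R (T f) x) - (T f x + T (R (T f)) x) - z * f x"
        using elim by simp
      finally show ?case by (simp add: G_def algebra_simps)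
    qed
  qed
  have Gpow: "l2_norm M (G f) \<le> K' * l2_norm M f * \<rho> ^ n" if f: "f \<in> L2 M" for f n
    using f
  proof (induction n arbitrary: f)
    case 0
    then show ?case using Gnorm by simp
  next
    case (Suc n)
    have "cmod z * l2_norm M (G f) = l2_norm M (\<lambda>x. z * G f x)" by (simp add: l2_norm_scale)
    also have "\<dots> = l2_norm M (G (T f))"
      by (intro l2_norm_cong_AE[OF Gstep[OF Suc.prems]] L2_measurable L2_scale GL2 T Suc.prems)
    also have "\<dots> \<le> K' * l2_norm M (T f) * \<rho> ^ n" by (rule Suc.IH[OF T[OF Suc.prems]])
    also have "\<dots> \<le> K' * (r * l2_norm M f) * \<rho> ^ n"
      using bound[OF Suc.prems] \<rho> by (intro mult_right_mono mult_left_mono) (auto simp: K'_def)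
    finally have "l2_norm M (G f) \<le> K' * (r * l2_norm M f) * \<rho> ^ n / cmod z"
      using z by (simp add: pos_le_divide_eq mult.commute)
    then show ?case by (simp add: \<rho>_def power_divide mult_ac)
  qed
  have G0: "AE x in M. G f x = 0" if f: "f \<in> L2 M" for f
  proof (rule l2_norm_eq_0_AE[OF GL2[OF f]])
    have "(\<lambda>n. K' * l2_norm M f * \<rho> ^ n) \<longlonglongrightarrow> K' * l2_norm M f * 0"
      using \<rho> by (intro tendsto_mult tendsto_const LIMSEQ_power_zero) simp
    then have "l2_norm M (G f) \<le> 0"
      by (intro LIMSEQ_le_const) (auto intro: Gpow f)
    then show "l2_norm M (G f) = 0" by (simp add: antisym)
  qed
  have left: "AE x in M. R (\<lambda>t. z * f t - T f t) x = f x" if f: "f \<in> L2 M" for f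
  proof -
    have "AE x in M. R (\<lambda>x. z * f x + (-1) * T f x) x = R (\<lambda>x. z * f x) x + R (\<lambda>x. (-1) * T f x) x"
      by (intro Radd L2_scale T f)
    with Rscale[OF f, of z] Rscale[OF T[OF f], of "-1"] step[OF f] show ?thesis
      by eventually_elim simp
  qed
  have right: "AE x in M. z * R f x - T (R f) x = f x" if "f \<in> L2 M" for f
    using G0[OF that] by eventually_elim (simp add: G_def)
  have "l2_bounded_operator M R"
    unfolding l2_bounded_operator_def using R Radd Rscale Rnorm by blast
  then show ?thesis unfolding l2_spectrum_def using left right by blast
qed

lemma l2_spectral_radius_le:
  assumes "\<And>f. f \<in> L2 M \<Longrightarrow> T f \<in> L2 M"
    and "\<And>f g. f \<in> L2 M \<Longrightarrow> g \<in> L2 M \<Longrightarrow> AE x in M. T (\<lambda>x. f x + g x) x = T f x + T g x"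
    and "\<And>c f. f \<in> L2 M \<Longrightarrow> AE x in M. T (\<lambda>x. c * f x) x = c * T f x"
    and "\<And>f. f \<in> L2 M \<Longrightarrow> l2_norm M (T f) \<le> r * l2_norm M f"
    and "0 < r"
  shows "l2_spectral_radius M T \<le> ennreal r"
  unfolding l2_spectral_radius_def
proof (rule SUP_least)
  fix z assume "z \<in> l2_spectrum M T"
  then have "\<not> r < cmod z" using not_in_l2_spectrum[of M T r z] assms by blast
  then show "ennreal (cmod z) \<le> ennreal r" by (simp add: ennreal_leI)
qed

subsection \<open>Orthogonal projections\<close>

lemma l2_inner_diff_left:
  assumes "f \<in> L2 M" "g \<in> L2 M" "h \<in> L2 M"
  shows "l2_inner M (\<lambda>x. f x - g x) h = l2_inner M f h - l2_inner M g h"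
  using L2_integrable_mult[OF assms(1,3)] L2_integrable_mult[OF assms(2,3)]
  by (simp add: l2_inner_def left_diff_distrib)

lemma l2_inner_add_left:
  assumes "f \<in> L2 M" "g \<in> L2 M" "h \<in> L2 M"
  shows "l2_inner M (\<lambda>x. f x + g x) h = l2_inner M f h + l2_inner M g h"
  using L2_integrable_mult[OF assms(1,3)] L2_integrable_mult[OF assms(2,3)]
  by (simp add: l2_inner_def distrib_right)

lemma l2_inner_scale_left: "l2_inner M (\<lambda>x. c * f x) h = c * l2_inner M f h"
  by (simp add: l2_inner_def mult.assoc)

lemma l2_inner_commute: "l2_inner M g f = cnj (l2_inner M f g)"
proof -
  have "cnj (l2_inner M f g) = (\<integral>x. cnj (f x * cnj (g x)) \<partial>M)"
    unfolding l2_inner_def by (rule Bochner_Integration.integral_cnj[symmetric])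
  then show ?thesis by (simp add: l2_inner_def mult.commute)
qed

lemma l2_inner_cong_AE:
  assumes "AE x in M. f x = f' x" "AE x in M. g x = g' x"
    and "f \<in> borel_measurable M" "f' \<in> borel_measurable M" "g \<in> borel_measurable M" "g' \<in> borel_measurable M"
  shows "l2_inner M f g = l2_inner M f' g'"
proof -
  note [measurable] = assms(3-)
  show ?thesis unfolding l2_inner_def
    by (rule integral_cong_AE) (measurable, use assms(1,2) in \<open>eventually_elim, simp\<close>)
qed

lemma l2_inner_self: "l2_inner M f f = of_real ((l2_norm M f)\<^sup>2)"
proof -
  have "l2_inner M f f = (\<integral>x. complex_of_real ((cmod (f x))\<^sup>2) \<partial>M)"
    unfolding l2_inner_def by (simp only: complex_norm_square)
  then show ?thesis by (simp only: integral_complex_of_real l2_norm_square)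
qed

lemma l2_pythagoras:
  assumes f: "f \<in> L2 M" and g: "g \<in> L2 M" and "l2_inner M f g = 0"
  shows "(l2_norm M (\<lambda>x. f x + g x))\<^sup>2 = (l2_norm M f)\<^sup>2 + (l2_norm M g)\<^sup>2"
proof -
  have fg: "(\<lambda>x. f x + g x) \<in> L2 M" by (rule L2_add[OF f g])
  have "l2_inner M (\<lambda>x. f x + g x) (\<lambda>x. f x + g x) = l2_inner M f (\<lambda>x. f x + g x) + l2_inner M g (\<lambda>x. f x + g x)"
    by (rule l2_inner_add_left[OF f g fg])
  also have "\<dots> = cnj (l2_inner M f f + l2_inner M g f) + cnj (l2_inner M f g + l2_inner M g g)"
    by (simp only: l2_inner_commute[of M f "\<lambda>x. f x + g x"] l2_inner_commute[of M g "\<lambda>x. f x + g x"]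
        l2_inner_add_left[OF f g f] l2_inner_add_left[OF f g g])
  also have "\<dots> = of_real ((l2_norm M f)\<^sup>2 + (l2_norm M g)\<^sup>2)"
    using assms(3) l2_inner_commute[of M g f] by (simp add: l2_inner_self)
  finally show ?thesis unfolding l2_inner_self of_real_eq_iff .
qed

text \<open>Existence of the projection is taken as an assumption; conditional expectation supplies
  it for the subspaces at hand.\<close>

locale l2_projection =
  fixes M :: "'a measure" and S :: "('a \<Rightarrow> complex) set"
  assumes subset: "S \<subseteq> L2 M"
    and add: "f \<in> S \<Longrightarrow> g \<in> S \<Longrightarrow> (\<lambda>x. f x + g x) \<in> S"
    and scale: "f \<in> S \<Longrightarrow> (\<lambda>x. c * f x) \<in> S"
    and exists_orthogonal: "f \<in> L2 M \<Longrightarrow> \<exists>g\<in>S. \<forall>h\<in>S. l2_inner M (\<lambda>x. f x - g x) h = 0"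
begin

lemma mem_L2: "f \<in> S \<Longrightarrow> f \<in> L2 M"
  using subset by blast

lemma diff: "f \<in> S \<Longrightarrow> g \<in> S \<Longrightarrow> (\<lambda>x. f x - g x) \<in> S"
  using add[OF _ scale[of g "-1"], of f] by simp

lemma proj_spec:
  assumes "f \<in> L2 M"
  shows "l2_proj M S f \<in> S \<and> (\<forall>h\<in>S. l2_inner M (\<lambda>x. f x - l2_proj M S f x) h = 0)"
proof -
  have "\<exists>g. g \<in> S \<and> (\<forall>h\<in>S. l2_inner M (\<lambda>x. f x - g x) h = 0)"
    using exists_orthogonal[OF assms] by blast
  then show ?thesis unfolding l2_proj_def by (rule someI_ex)
qed

lemma proj_mem: "f \<in> L2 M \<Longrightarrow> l2_proj M S f \<in> S"
  using proj_spec by blast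

lemma proj_L2: "f \<in> L2 M \<Longrightarrow> l2_proj M S f \<in> L2 M"
  using proj_mem mem_L2 by blast

lemma proj_orthogonal: "f \<in> L2 M \<Longrightarrow> h \<in> S \<Longrightarrow> l2_inner M (\<lambda>x. f x - l2_proj M S f x) h = 0"
  using proj_spec by blast

lemma proj_inner: "f \<in> L2 M \<Longrightarrow> h \<in> S \<Longrightarrow> l2_inner M (l2_proj M S f) h = l2_inner M f h"
  using proj_orthogonal[of f h] by (simp add: l2_inner_diff_left proj_L2 mem_L2)

text \<open>Two candidates differ by an element of \<open>S\<close> that is orthogonal to itself.
  Since \<open>l2_proj\<close> chooses a representative arbitrarily, agreement is only almost
  everywhere.\<close>

lemma proj_unique:
  assumes f: "f \<in> L2 M" and g: "g \<in> S" and orth: "\<And>h. h \<in> S \<Longrightarrow> l2_inner M g h = l2_inner M f h"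
  shows "AE x in M. l2_proj M S f x = g x"
proof -
  let ?d = "\<lambda>x. l2_proj M S f x - g x"
  have d: "?d \<in> S" by (intro diff proj_mem f g)
  have "l2_inner M ?d ?d = 0"
    using l2_inner_diff_left[OF proj_L2[OF f] mem_L2[OF g] mem_L2[OF d]] proj_inner[OF f d] orth[OF d] by simp
  then have "l2_norm M ?d = 0" by (simp add: l2_inner_self)
  from l2_norm_eq_0_AE[OF mem_L2[OF d] this] show ?thesis by simp
qed

lemma proj_add:
  assumes "f \<in> L2 M" "g \<in> L2 M"
  shows "AE x in M. l2_proj M S (\<lambda>x. f x + g x) x = l2_proj M S f x + l2_proj M S g x"
  by (rule proj_unique)
    (use assms in \<open>auto intro!: L2_add add proj_mem simp: l2_inner_add_left proj_inner proj_L2 mem_L2\<close>)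

lemma proj_scale:
  assumes "f \<in> L2 M"
  shows "AE x in M. l2_proj M S (\<lambda>x. c * f x) x = c * l2_proj M S f x"
  by (rule proj_unique)
    (use assms in \<open>auto intro!: L2_scale scale proj_mem simp: l2_inner_scale_left proj_inner\<close>)

lemma proj_cong:
  assumes "f \<in> L2 M" "g \<in> L2 M" "AE x in M. f x = g x"
  shows "AE x in M. l2_proj M S f x = l2_proj M S g x"
proof (rule proj_unique[OF assms(1) proj_mem[OF assms(2)]])
  fix h assume h: "h \<in> S"
  show "l2_inner M (l2_proj M S g) h = l2_inner M f h"
    unfolding proj_inner[OF assms(2) h]
    by (rule l2_inner_cong_AE) (use assms mem_L2[OF h] in \<open>auto dest: L2_measurable\<close>)
qed

lemma proj_of_mem: "f \<in> S \<Longrightarrow> AE x in M. l2_proj M S f x = f x"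
  by (rule proj_unique) (auto simp: mem_L2)

lemma proj_pythagoras:
  assumes f: "f \<in> L2 M"
  shows "(l2_norm M f)\<^sup>2 = (l2_norm M (l2_proj M S f))\<^sup>2 + (l2_norm M (\<lambda>x. f x - l2_proj M S f x))\<^sup>2"
  using l2_pythagoras[OF L2_diff[OF f proj_L2[OF f]] proj_L2[OF f] proj_orthogonal[OF f proj_mem[OF f]]] by simp

lemma proj_diff_const:
  assumes f: "f \<in> L2 M" and c: "(\<lambda>_. c) \<in> S"
  shows "AE x in M. l2_proj M S (\<lambda>x. f x - c) x = l2_proj M S f x - c"
proof -
  have "AE x in M. l2_proj M S (\<lambda>x. f x + (-1) * c) x = l2_proj M S f x + l2_proj M S (\<lambda>x. (-1) * c) x"
    by (rule proj_add[OF f L2_scale[OF mem_L2[OF c]]])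
  moreover have "AE x in M. l2_proj M S (\<lambda>x. (-1) * c) x = (-1) * c"
    by (rule proj_of_mem[OF scale[OF c]])
  ultimately show ?thesis by eventually_elim simp
qed

end

section \<open>Spectral gap criterion for a product of two projections\<close>

text \<open>Let g be the projection onto \<open>S\<close> of f minus its mean and h the projection
  of g onto \<open>T\<close>. Pythagoras turns the gap hypothesis into |g|^2 \<le> K (|g|^2 -
  |h|^2), that is |h|^2 \<le> (1 - 1/K) |g|^2. So the operator has norm at most sqrt (1 - 1/K),
  which bounds its spectral radius.\<close>

lemma (in prob_space) l2_spectral_radius_projections_less_1:
  assumes S: "l2_projection M S" "\<And>c. (\<lambda>_. c) \<in> S"
    and T: "l2_projection M T" "\<And>c. (\<lambda>_. c) \<in> T"
    and gap: "\<And>g h. g \<in> S \<Longrightarrow> h \<in> T \<Longrightarrow>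
      \<exists>c. (l2_norm M (\<lambda>x. g x - c))\<^sup>2 \<le> K * (l2_norm M (\<lambda>x. g x - h x))\<^sup>2"
    and K: "1 < K"
  shows "l2_spectral_radius M (\<lambda>f x. (l2_proj M T \<circ> l2_proj M S) f x - mean_op M f x) < 1"
proof -
  interpret S: l2_projection M S by fact
  interpret T: l2_projection M T by fact
  let ?PS = "l2_proj M S" and ?PT = "l2_proj M T"
  define r where "r = sqrt (1 - 1 / K)"
  have r: "0 < r" "r < 1" using K by (auto simp: r_def)
  have op_L2: "(\<lambda>x. ?PT (?PS f) x - mean_op M f x) \<in> L2 M" if "f \<in> L2 M" for f
    unfolding mean_op_def by (intro L2_diff T.proj_L2 S.proj_L2 L2_const that)
  have op_add: "AE x in M. ?PT (?PS (\<lambda>x. f x + g x)) x - mean_op M (\<lambda>x. f x + g x) x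
      = (?PT (?PS f) x - mean_op M f x) + (?PT (?PS g) x - mean_op M g x)"
    if f: "f \<in> L2 M" and g: "g \<in> L2 M" for f g
  proof -
    have "AE x in M. ?PT (?PS (\<lambda>x. f x + g x)) x = ?PT (\<lambda>x. ?PS f x + ?PS g x) x"
      by (intro T.proj_cong S.proj_L2 L2_add f g S.proj_add)
    moreover have "AE x in M. ?PT (\<lambda>x. ?PS f x + ?PS g x) x = ?PT (?PS f) x + ?PT (?PS g) x"
      by (intro T.proj_add S.proj_L2 f g)
    ultimately show ?thesis
      by eventually_elim (simp add: mean_op_def L2_integrable f g)
  qed
  have op_scale: "AE x in M. ?PT (?PS (\<lambda>x. c * f x)) x - mean_op M (\<lambda>x. c * f x) x
      = c * (?PT (?PS f) x - mean_op M f x)" if f: "f \<in> L2 M" for f c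
  proof -
    have "AE x in M. ?PT (?PS (\<lambda>x. c * f x)) x = ?PT (\<lambda>x. c * ?PS f x) x"
      by (intro T.proj_cong S.proj_L2 L2_scale f S.proj_scale)
    moreover have "AE x in M. ?PT (\<lambda>x. c * ?PS f x) x = c * ?PT (?PS f) x"
      by (intro T.proj_scale S.proj_L2 f)
    ultimately show ?thesis
      by eventually_elim (simp add: mean_op_def right_diff_distrib)
  qed
  have op_norm: "l2_norm M (\<lambda>x. ?PT (?PS f) x - mean_op M f x) \<le> r * l2_norm M f" if f: "f \<in> L2 M" for f
  proof (rule power2_le_imp_le)
    define m where "m = (\<integral>x. f x \<partial>M)"
    have inner_const: "l2_inner M p (\<lambda>_. c) = (\<integral>x. p x \<partial>M) * cnj c" for p c
      by (simp add: l2_inner_def)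
    \<comment> \<open>A function of mean zero is orthogonal to the constants, so subtracting one
      cannot decrease its norm.\<close>
    have centred: "(l2_norm M p)\<^sup>2 \<le> (l2_norm M (\<lambda>x. p x - c))\<^sup>2"
      if "p \<in> L2 M" "(\<integral>x. p x \<partial>M) = 0" for p c
      using l2_pythagoras[OF that(1) L2_const[of "- c"]] that(2) by (simp add: inner_const)
    let ?f0 = "\<lambda>x. f x - m"
    have f0: "?f0 \<in> L2 M" by (intro L2_diff f L2_const)
    have f0_mean: "(\<integral>x. ?f0 x \<partial>M) = 0" by (simp add: L2_integrable[OF f] m_def prob_space)
    define g where "g = ?PS ?f0"
    define h where "h = ?PT g"
    have g: "g \<in> S" unfolding g_def by (rule S.proj_mem[OF f0])
    have gL2: "g \<in> L2 M" by (rule S.mem_L2[OF g])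
    have h: "h \<in> T" unfolding h_def by (rule T.proj_mem[OF gL2])
    have "l2_inner M g (\<lambda>_. 1) = l2_inner M ?f0 (\<lambda>_. 1)"
      unfolding g_def by (rule S.proj_inner[OF f0 S(2)])
    then have g_mean: "(\<integral>x. g x \<partial>M) = 0" using f0_mean by (simp add: inner_const)
    \<comment> \<open>Both projections fix constants, so the mean may be removed before or after
      applying them.\<close>
    have "AE x in M. h x = ?PT (\<lambda>x. ?PS f x - m) x"
      unfolding h_def
      by (rule T.proj_cong[OF gL2 L2_diff[OF S.proj_L2[OF f] L2_const]])
        (use S.proj_diff_const[OF f S(2)] in \<open>simp add: g_def\<close>)
    with T.proj_diff_const[OF S.proj_L2[OF f] T(2)[of m]]
    have "AE x in M. ?PT (?PS f) x - mean_op M f x = h x"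
      by eventually_elim (simp add: mean_op_def m_def)
    then have "(l2_norm M (\<lambda>x. ?PT (?PS f) x - mean_op M f x))\<^sup>2 = (l2_norm M h)\<^sup>2"
      by (subst l2_norm_cong_AE) (use op_L2[OF f] T.mem_L2[OF h] in \<open>auto dest: L2_measurable\<close>)
    also have "\<dots> \<le> r\<^sup>2 * (l2_norm M g)\<^sup>2"
    proof -
      obtain c where "(l2_norm M (\<lambda>x. g x - c))\<^sup>2 \<le> K * (l2_norm M (\<lambda>x. g x - h x))\<^sup>2"
        using gap[OF g h] by blast
      with centred[OF gL2 g_mean, of c] T.proj_pythagoras[OF gL2]
      have "(l2_norm M g)\<^sup>2 \<le> K * ((l2_norm M g)\<^sup>2 - (l2_norm M h)\<^sup>2)" by (simp add: h_def)
      then have "(l2_norm M g)\<^sup>2 / K \<le> (l2_norm M g)\<^sup>2 - (l2_norm M h)\<^sup>2"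
        using K by (simp add: pos_divide_le_eq mult.commute)
      then show ?thesis using K by (simp add: r_def left_diff_distrib)
    qed
    also have "\<dots> \<le> r\<^sup>2 * (l2_norm M f)\<^sup>2"
    proof (rule mult_left_mono)
      have "(l2_norm M g)\<^sup>2 \<le> (l2_norm M ?f0)\<^sup>2" using S.proj_pythagoras[OF f0] by (simp add: g_def)
      \<comment> \<open>As f is \<open>?f0\<close> minus the constant -m, this says that centring
        does not increase the norm.\<close>
      also have "\<dots> \<le> (l2_norm M (\<lambda>x. ?f0 x - (- m)))\<^sup>2" by (rule centred[OF f0 f0_mean])
      finally show "(l2_norm M g)\<^sup>2 \<le> (l2_norm M f)\<^sup>2" by simp
    qed simp
    finally show "(l2_norm M (\<lambda>x. ?PT (?PS f) x - mean_op M f x))\<^sup>2 \<le> (r * l2_norm M f)\<^sup>2"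
      by (simp add: power_mult_distrib)
  qed (use r in simp)
  have "l2_spectral_radius M (\<lambda>f x. ?PT (?PS f) x - mean_op M f x) \<le> ennreal r"
    by (rule l2_spectral_radius_le) (fact op_L2 op_add op_scale op_norm r(1))+
  also have "\<dots> < 1" using r by (simp add: ennreal_less_one_iff)
  finally show ?thesis by simp
qed

section \<open>Conditional expectation as orthogonal projection\<close>

text \<open>The projection is the conditional expectation, formed separately for real and imaginary
  parts because \<open>real_cond_exp\<close> acts on real functions. Factors measurable for
  \<open>F\<close> can be pulled out of it, which gives orthogonality.\<close>

lemma (in prob_space) l2_projection_subalgebra:
  assumes F: "subalgebra M F"
  shows "l2_projection M {f \<in> L2 M. \<exists>g\<in>L2 M. g \<in> borel_measurable F \<and> (AE x in M. f x = g x)}"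
proof -
  interpret finite_measure_subalgebra M F by unfold_locales (rule F)
  interpret sigma_finite_subalgebra M F
    by (rule finite_measure_subalgebra_is_sigma_finite) unfold_locales
  have square_int: "integrable M (\<lambda>x. (real_cond_exp M F p x)\<^sup>2)"
    if p: "p \<in> borel_measurable M" "integrable M (\<lambda>x. (p x)\<^sup>2)" for p :: "'a \<Rightarrow> real"
  proof (rule Bochner_Integration.integrable_bound)
    have "integrable M p" by (rule square_integrable_imp_integrable[OF p])
    then have "AE x in M. (real_cond_exp M F p x)\<^sup>2 \<le> real_cond_exp M F (\<lambda>x. (p x)\<^sup>2) x"
      by (intro real_cond_exp_jensens_inequality(2)[where I = UNIV]) (use p convex_power2 in auto)
    then show "AE x in M. norm ((real_cond_exp M F p x)\<^sup>2) \<le> norm (real_cond_exp M F (\<lambda>x. (p x)\<^sup>2) x)"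
      by eventually_elim simp
    show "integrable M (real_cond_exp M F (\<lambda>x. (p x)\<^sup>2))"
      by (rule real_cond_exp_int(1)[OF p(2)])
  qed measurable
  show ?thesis
  proof
    fix f assume f: "f \<in> L2 M"
    note [measurable] = L2_measurable[OF f]
    define a where "a x = Re (f x)" for x
    define b where "b x = Im (f x)" for x
    have [measurable]: "a \<in> borel_measurable M" "b \<in> borel_measurable M"
      unfolding a_def b_def by measurable
    have a2: "integrable M (\<lambda>x. (a x)\<^sup>2)" and b2: "integrable M (\<lambda>x. (b x)\<^sup>2)"
      by (rule Bochner_Integration.integrable_bound[OF L2_integrable_square[OF f]];
          simp add: a_def b_def cmod_power2)+
    let ?a = "real_cond_exp M F a" and ?b = "real_cond_exp M F b"
    define g where "g x = Complex (?a x) (?b x)" for x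
    have g_eq: "g x = complex_of_real (?a x) + \<i> * complex_of_real (?b x)" for x
      by (simp add: g_def complex_eq_iff)
    have gF: "g \<in> borel_measurable F" unfolding g_eq[abs_def] by measurable
    have gM [measurable]: "g \<in> borel_measurable M" by (rule measurable_from_subalg[OF F gF])
    have g: "g \<in> L2 M"
      using square_int[OF _ a2] square_int[OF _ b2] by (simp add: L2_def cmod_power2 g_def)
    show "\<exists>g\<in>{f \<in> L2 M. \<exists>g\<in>L2 M. g \<in> borel_measurable F \<and> (AE x in M. f x = g x)}.
        \<forall>h\<in>{f \<in> L2 M. \<exists>g\<in>L2 M. g \<in> borel_measurable F \<and> (AE x in M. f x = g x)}.
          l2_inner M (\<lambda>x. f x - g x) h = 0"
    proof (intro bexI ballI)
      fix h assume "h \<in> {f \<in> L2 M. \<exists>g\<in>L2 M. g \<in> borel_measurable F \<and> (AE x in M. f x = g x)}"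
      then obtain k where hk: "h \<in> L2 M" "k \<in> L2 M" "k \<in> borel_measurable F" "AE x in M. h x = k x" by blast
      note [measurable] = hk(3) L2_measurable[OF hk(2)]
      have kint: "integrable M (\<lambda>x. (Re (k x))\<^sup>2)" "integrable M (\<lambda>x. (Im (k x))\<^sup>2)"
        by (rule Bochner_Integration.integrable_bound[OF L2_integrable_square[OF hk(2)]];
            simp add: cmod_power2)+
      have orth: "integrable M (\<lambda>x. q x * (p x - real_cond_exp M F p x))"
          "(\<integral>x. q x * (p x - real_cond_exp M F p x) \<partial>M) = 0"
        if [measurable]: "p \<in> borel_measurable M" "q \<in> borel_measurable F"
          and sq: "integrable M (\<lambda>x. (p x)\<^sup>2)" "integrable M (\<lambda>x. (q x)\<^sup>2)" for p q :: "'a \<Rightarrow> real"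
      proof -
        have [measurable]: "q \<in> borel_measurable M" by (rule measurable_from_subalg[OF F that(2)])
        have pq: "integrable M (\<lambda>x. q x * p x)"
        proof (rule Bochner_Integration.integrable_bound[OF Bochner_Integration.integrable_add[OF sq]])
          have "\<bar>q x * p x\<bar> \<le> (p x)\<^sup>2 + (q x)\<^sup>2" for x
          proof -
            have "2 * (\<bar>p x\<bar> * \<bar>q x\<bar>) \<le> (p x)\<^sup>2 + (q x)\<^sup>2"
              using sum_squares_bound[of "\<bar>p x\<bar>" "\<bar>q x\<bar>"] by (simp add: mult.assoc)
            moreover have "0 \<le> \<bar>p x\<bar> * \<bar>q x\<bar>" by simp
            ultimately show ?thesis unfolding abs_mult mult.commute[of "\<bar>q x\<bar>"] by argo
          qed
          then show "AE x in M. norm (q x * p x) \<le> norm ((p x)\<^sup>2 + (q x)\<^sup>2)" by simp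
        qed measurable
        note ce = real_cond_exp_intg[OF pq that(2,1)]
        show "integrable M (\<lambda>x. q x * (p x - real_cond_exp M F p x))"
          using pq ce(1) by (simp add: right_diff_distrib)
        show "(\<integral>x. q x * (p x - real_cond_exp M F p x) \<partial>M) = 0"
          using pq ce by (simp add: right_diff_distrib)
      qed
      let ?I = "\<lambda>x. (f x - g x) * cnj (k x)"
      have I: "integrable M ?I" by (rule L2_integrable_mult[OF L2_diff[OF f g] hk(2)])
      have "l2_inner M (\<lambda>x. f x - g x) h = (\<integral>x. ?I x \<partial>M)"
        unfolding l2_inner_def[of M _ k, symmetric]
        by (rule l2_inner_cong_AE) (use hk(1,4) in \<open>auto dest: L2_measurable\<close>)
      also have "\<dots> = 0"
      proof (rule complex_eqI)
        \<comment> \<open>The real and imaginary parts of (f - g) times the conjugate of k split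
          into real products of the kind treated by \<open>orth\<close>.\<close>
        have "Re (\<integral>x. ?I x \<partial>M) = (\<integral>x. Re (?I x) \<partial>M)"
          using I by (simp only: integral_Re)
        also have "\<dots> = (\<integral>x. Re (k x) * (a x - ?a x) + Im (k x) * (b x - ?b x) \<partial>M)"
          by (intro Bochner_Integration.integral_cong) (auto simp: a_def b_def g_def algebra_simps)
        also have "\<dots> = 0"
          by (subst Bochner_Integration.integral_add) (auto simp: orth a2 b2 kint)
        finally show "Re (\<integral>x. ?I x \<partial>M) = Re 0" by simp
        have "Im (\<integral>x. ?I x \<partial>M) = (\<integral>x. Im (?I x) \<partial>M)"
          using I by (simp only: integral_Im)
        also have "\<dots> = (\<integral>x. Re (k x) * (b x - ?b x) - Im (k x) * (a x - ?a x) \<partial>M)"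
          by (intro Bochner_Integration.integral_cong) (auto simp: a_def b_def g_def algebra_simps)
        also have "\<dots> = 0"
          by (subst Bochner_Integration.integral_diff) (auto simp: orth a2 b2 kint)
        finally show "Im (\<integral>x. ?I x \<partial>M) = Im 0" by simp
      qed
      finally show "l2_inner M (\<lambda>x. f x - g x) h = 0" .
    qed (use g gF in auto)
  next
    fix f g assume "f \<in> {f \<in> L2 M. \<exists>g\<in>L2 M. g \<in> borel_measurable F \<and> (AE x in M. f x = g x)}"
      "g \<in> {f \<in> L2 M. \<exists>g\<in>L2 M. g \<in> borel_measurable F \<and> (AE x in M. f x = g x)}"
    then obtain f' g' where fg: "f \<in> L2 M" "g \<in> L2 M" "f' \<in> L2 M" "g' \<in> L2 M"
      "f' \<in> borel_measurable F" "g' \<in> borel_measurable F" "AE x in M. f x = f' x" "AE x in M. g x = g' x" by blast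
    have "AE x in M. f x + g x = f' x + g' x" using fg(7,8) by eventually_elim simp
    then show "(\<lambda>x. f x + g x) \<in> {f \<in> L2 M. \<exists>g\<in>L2 M. g \<in> borel_measurable F \<and> (AE x in M. f x = g x)}"
      using fg L2_add[of f M g] L2_add[of f' M g'] borel_measurable_add[OF fg(5,6)] by blast
  next
    fix f c assume "f \<in> {f \<in> L2 M. \<exists>g\<in>L2 M. g \<in> borel_measurable F \<and> (AE x in M. f x = g x)}"
    then obtain f' where fg: "f \<in> L2 M" "f' \<in> L2 M"
      "f' \<in> borel_measurable F" "AE x in M. f x = f' x" by blast
    have "AE x in M. c * f x = c * f' x" using fg(4) by eventually_elim simp
    moreover have "(\<lambda>x. c * f' x) \<in> borel_measurable F" using fg(3) by measurable
    ultimately show "(\<lambda>x. c * f x) \<in> {f \<in> L2 M. \<exists>g\<in>L2 M. g \<in> borel_measurable F \<and> (AE x in M. f x = g x)}"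
      using fg L2_scale[of f M c] L2_scale[of f' M c] by blast
  qed auto
qed

subsection \<open>Gaussian and Gamma integrals\<close>

text \<open>The integrand is a multiple of the normal density with mean c and variance 1 /
  b.\<close>

lemma nn_integral_gaussian:
  fixes b c :: real
  assumes b: "0 < b"
  shows "(\<integral>\<^sup>+x. ennreal (exp (- (b * (x - c)\<^sup>2 / 2))) \<partial>lborel) = ennreal (sqrt (2 * pi / b))"
proof -
  define \<sigma> where "\<sigma> = 1 / sqrt b"
  have \<sigma>: "0 < \<sigma>" "\<sigma>\<^sup>2 = 1 / b" using b by (auto simp: \<sigma>_def power_divide)
  interpret prob_space "density lborel (normal_density c \<sigma>)" by (rule prob_space_normal_density[OF \<sigma>(1)])
  have density: "exp (- (b * (x - c)\<^sup>2 / 2)) = sqrt (2 * pi / b) * normal_density c \<sigma> x" for x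
    using b by (simp add: normal_density_def \<sigma>(2) real_sqrt_divide field_simps)
  have "(\<integral>\<^sup>+x. ennreal (normal_density c \<sigma> x) \<partial>lborel) = 1"
    using emeasure_space_1 by (simp add: emeasure_density)
  then show ?thesis
    unfolding density using b by (simp add: ennreal_mult nn_integral_cmult)
qed

text \<open>The mean deviation \<open>\<sigma> * sqrt (2 / pi)\<close> of the same normal law, times
  the Gaussian mass sqrt (2 pi / b).\<close>

lemma nn_integral_gaussian_abs:
  fixes b c :: real
  assumes b: "0 < b"
  shows "(\<integral>\<^sup>+x. ennreal (\<bar>x - c\<bar> * exp (- (b * (x - c)\<^sup>2 / 2))) \<partial>lborel) = ennreal (2 / b)"
proof -
  define \<sigma> where "\<sigma> = 1 / sqrt b"
  have \<sigma>: "0 < \<sigma>" "\<sigma>\<^sup>2 = 1 / b" using b by (auto simp: \<sigma>_def power_divide)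
  have density: "\<bar>x - c\<bar> * exp (- (b * (x - c)\<^sup>2 / 2)) = sqrt (2 * pi / b) * (normal_density c \<sigma> x * \<bar>x - c\<bar>)" for x
    using b by (simp add: normal_density_def \<sigma>(2) real_sqrt_divide field_simps)
  have "has_bochner_integral lborel (\<lambda>x. normal_density c \<sigma> x * \<bar>x - c\<bar>) (\<sigma> * sqrt (2 / pi))"
    using normal_moment_abs_odd[OF \<sigma>(1), of c 0] by simp
  then have "(\<integral>\<^sup>+x. ennreal (normal_density c \<sigma> x * \<bar>x - c\<bar>) \<partial>lborel) = ennreal (\<sigma> * sqrt (2 / pi))"
    by (simp add: has_bochner_integral_iff nn_integral_eq_integral)
  moreover have "sqrt (2 * pi / b) * (\<sigma> * sqrt (2 / pi)) = 2 / b"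
    using b by (simp add: \<sigma>_def real_sqrt_divide real_sqrt_mult)
  ultimately show ?thesis
    unfolding density using b \<sigma> by (simp add: ennreal_mult' nn_integral_cmult) (simp add: ennreal_mult'[symmetric])
qed

text \<open>The substitution t = b u reduces this to Euler's integral.\<close>

lemma nn_integral_Gamma:
  fixes s b :: real
  assumes s: "0 < s" and b: "0 < b"
  shows "(\<integral>\<^sup>+u. indicator {0<..} u * ennreal (u powr (s - 1) * exp (- (b * u))) \<partial>lborel) = ennreal (Gamma s / b powr s)"
proof -
  have "(\<integral>\<^sup>+u. indicator {0<..} u * ennreal (u powr (s - 1) * exp (- (b * u))) \<partial>lborel)
      = ennreal (1 / b) * (\<integral>\<^sup>+t. indicator {0<..} (t / b) * ennreal ((t / b) powr (s - 1) * exp (- t)) \<partial>lborel)"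
    by (subst nn_integral_real_affine[where c = "1 / b" and t = 0]) (use b in auto)
  also have "(\<integral>\<^sup>+t. indicator {0<..} (t / b) * ennreal ((t / b) powr (s - 1) * exp (- t)) \<partial>lborel)
      = (\<integral>\<^sup>+t. ennreal (1 / b powr (s - 1)) * ennreal (indicator {0..} t * t powr (s - 1) / exp t) \<partial>lborel)"
    by (intro nn_integral_cong)
      (use b in \<open>auto simp: indicator_def powr_divide exp_minus ennreal_mult[symmetric] field_simps zero_less_divide_iff\<close>)
  also have "\<dots> = ennreal (1 / b powr (s - 1)) * ennreal (Gamma s)"
    by (subst nn_integral_cmult) (auto simp: Gamma_conv_nn_integral_real[OF s])
  also have "ennreal (1 / b) * \<dots> = ennreal (Gamma s / b powr s)"
    using b Gamma_real_pos[OF s] by (simp add: ennreal_mult[symmetric] powr_diff)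
  finally show ?thesis .
qed

lemma nn_integral_exponential:
  fixes b :: real
  assumes b: "0 < b"
  shows "(\<integral>\<^sup>+u. indicator {0<..} u * ennreal (exp (- (b * u))) \<partial>lborel) = ennreal (1 / b)"
proof -
  have "(\<integral>\<^sup>+u. indicator {0<..} u * ennreal (exp (- (b * u))) \<partial>lborel)
     = (\<integral>\<^sup>+u. indicator {0<..} u * ennreal (u powr (1 - 1) * exp (- (b * u))) \<partial>lborel)"
    by (intro nn_integral_cong) (auto simp: indicator_def)
  also have "\<dots> = ennreal (Gamma 1 / b powr 1)" by (rule nn_integral_Gamma[OF _ b]) simp
  finally show ?thesis using b by simp
qed

text \<open>
  Log-convexity is applied at \<open>7/4\<close>, midway between the explicit values at \<open>3/2\<close> and \<open>2\<close>.
  Interpolating directly between \<open>1/2\<close> and \<open>1\<close> would only give the constant \<open>1\<close>.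
\<close>

lemma Gamma_three_quarters_le: "Gamma (3/4 :: real) \<le> 19/20 * sqrt (sqrt pi)"
proof (rule power2_le_imp_le)
  have pos: "x \<notin> \<int>\<^sub>\<le>\<^sub>0" if "0 < x" for x :: real using that by (auto elim!: nonpos_Ints_cases)
  have g: "Gamma (7/4) = 3/4 * Gamma (3/4 :: real)" using Gamma_plus1[OF pos[of "3/4"]] by simp
  have g32: "Gamma (3/2 :: real) = sqrt pi / 2" using Gamma_plus1[OF pos[of "1/2"]] Gamma_one_half_real by simp
  have g2: "Gamma (2 :: real) = 1" using Gamma_plus1[OF pos[of 1]] by simp
  have "ln (Gamma (7/4 :: real)) \<le> 1/2 * ln (Gamma (3/2)) + 1/2 * ln (Gamma 2)"
    using convex_onD[OF log_convex_Gamma_real, of "1/2" "3/2" 2] by simp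
  then have "ln ((Gamma (7/4 :: real))\<^sup>2) \<le> ln (sqrt pi / 2)"
    by (simp add: g2 g32 ln_realpow)
  moreover have "0 < (Gamma (7/4 :: real))\<^sup>2"
    by (intro zero_less_power Gamma_real_pos) simp
  ultimately have "(Gamma (7/4 :: real))\<^sup>2 \<le> sqrt pi / 2"
    using ln_le_cancel_iff[of "(Gamma (7/4 :: real))\<^sup>2" "sqrt pi / 2"] by (simp del: zero_less_power2)
  then have "(Gamma (3/4 :: real))\<^sup>2 \<le> 8/9 * sqrt pi" by (simp add: g power_mult_distrib power_divide)
  \<comment> \<open>The margin is (19/20)^2 = 361/400 > 8/9.\<close>
  also have "\<dots> \<le> (19/20 * sqrt (sqrt pi))\<^sup>2" by (simp add: power_mult_distrib power_divide)
  finally show "(Gamma (3/4 :: real))\<^sup>2 \<le> (19/20 * sqrt (sqrt pi))\<^sup>2" .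
qed simp

subsection \<open>Lyapunov functions\<close>

definition lyap_w :: "real \<Rightarrow> real" where "lyap_w x = sqrt (sqrt (1 + x\<^sup>2))"
text \<open>Given u, w is normal with mean y and variance 1 / u, so the term added to 1 is the
  square root of the conditional mean of |w - y|.\<close>

definition lyap_u :: "real \<Rightarrow> real" where "lyap_u u = 1 + sqrt (sqrt (2 / (pi * u)))"

lemma lyap_measurable [measurable]: "lyap_w \<in> borel_measurable borel" "lyap_u \<in> borel_measurable borel"
  unfolding lyap_w_def[abs_def] lyap_u_def[abs_def] by measurable

lemma lyap_w_ge_1: "1 \<le> lyap_w x"
  by (simp add: lyap_w_def)

lemma lyap_u_ge_1: "0 < u \<Longrightarrow> 1 \<le> lyap_u u"
  by (simp add: lyap_u_def)

text \<open>The tangent bound \<open>sqrt x \<le> (q + x / q) / 2\<close> reduces the fractional Gaussian moment to the first one.\<close>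

lemma nn_integral_lyap_w:
  assumes u: "0 < u"
  shows "(\<integral>\<^sup>+x. ennreal (lyap_w (x - c) * exp (- (u * (x - c)\<^sup>2 / 2))) \<partial>lborel)
    \<le> ennreal (lyap_u u * sqrt (2 * pi / u))"
proof -
  \<comment> \<open>q^2 is the mean of |t|, the choice for which the tangent bound has mean exactly
    q.\<close>
  define q where "q = sqrt (sqrt (2 / (pi * u)))"
  have q: "0 < q" "q\<^sup>2 = sqrt (2 / (pi * u))" using u by (auto simp: q_def)
  have le: "lyap_w t \<le> (1 + q / 2) + \<bar>t\<bar> / (2 * q)" for t
  proof -
    have "sqrt (1 + t\<^sup>2) \<le> 1 + \<bar>t\<bar>" by (rule real_le_lsqrt) (auto simp: power2_eq_square algebra_simps)
    then have "lyap_w t \<le> sqrt (1 + \<bar>t\<bar>)" by (simp add: lyap_w_def)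
    also have "\<dots> \<le> 1 + sqrt \<bar>t\<bar>" by (rule real_le_lsqrt) (auto simp: power2_eq_square algebra_simps)
    also have "sqrt \<bar>t\<bar> \<le> q / 2 + \<bar>t\<bar> / (2 * q)"
    proof -
      have "2 * q * sqrt \<bar>t\<bar> \<le> q\<^sup>2 + \<bar>t\<bar>" using sum_squares_bound[of q "sqrt \<bar>t\<bar>"] by simp
      then have "sqrt \<bar>t\<bar> \<le> (q\<^sup>2 + \<bar>t\<bar>) / (2 * q)" using q by (simp add: pos_le_divide_eq mult.commute)
      also have "\<dots> = q / 2 + \<bar>t\<bar> / (2 * q)" using q by (simp add: field_simps power2_eq_square)
      finally show ?thesis .
    qed
    finally show ?thesis by simp
  qed
  have "(\<integral>\<^sup>+x. ennreal (lyap_w (x - c) * exp (- (u * (x - c)\<^sup>2 / 2))) \<partial>lborel)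
    \<le> (\<integral>\<^sup>+x. ennreal (1 + q / 2) * ennreal (exp (- (u * (x - c)\<^sup>2 / 2)))
        + ennreal (1 / (2 * q)) * ennreal (\<bar>x - c\<bar> * exp (- (u * (x - c)\<^sup>2 / 2))) \<partial>lborel)"
  proof (rule nn_integral_mono)
    fix x
    have "lyap_w (x - c) * exp (- (u * (x - c)\<^sup>2 / 2))
        \<le> ((1 + q / 2) + \<bar>x - c\<bar> / (2 * q)) * exp (- (u * (x - c)\<^sup>2 / 2))"
      by (rule mult_right_mono[OF le]) simp
    then show "ennreal (lyap_w (x - c) * exp (- (u * (x - c)\<^sup>2 / 2)))
      \<le> ennreal (1 + q / 2) * ennreal (exp (- (u * (x - c)\<^sup>2 / 2)))
        + ennreal (1 / (2 * q)) * ennreal (\<bar>x - c\<bar> * exp (- (u * (x - c)\<^sup>2 / 2)))"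
      using q by (simp add: ennreal_mult[symmetric] ennreal_plus[symmetric] distrib_right del: ennreal_plus)
  qed
  also have "\<dots> = ennreal (1 + q / 2) * ennreal (sqrt (2 * pi / u)) + ennreal (1 / (2 * q)) * ennreal (2 / u)"
    using nn_integral_gaussian[OF u, of c] nn_integral_gaussian_abs[OF u, of c]
    by (simp add: nn_integral_add nn_integral_cmult)
  also have "\<dots> = ennreal ((1 + q / 2) * sqrt (2 * pi / u) + 1 / (2 * q) * (2 / u))"
    using u q by (simp add: ennreal_mult[symmetric] ennreal_plus[symmetric] del: ennreal_plus)
  also have "(1 + q / 2) * sqrt (2 * pi / u) + 1 / (2 * q) * (2 / u) = lyap_u u * sqrt (2 * pi / u)"
  proof -
    \<comment> \<open>In unnormalised form: the first absolute moment 2 / u is q^2 times the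
      Gaussian mass.\<close>
    have "2 / u = q\<^sup>2 * sqrt (2 * pi / u)"
      unfolding q(2) real_sqrt_mult[symmetric] using u by (simp add: real_sqrt_divide real_sqrt_mult)
    then have "1 / (2 * q) * (2 / u) = q / 2 * sqrt (2 * pi / u)"
      using q(1) by (simp add: power2_eq_square)
    then show ?thesis by (simp add: lyap_u_def q_def[symmetric] algebra_simps)
  qed
  finally show ?thesis .
qed

text \<open>With a = 1 + x^2, the constant 1 in \<open>lyap_u\<close> gives the exponential integral
  2 / a, and the term in u^(-1/4) gives a Gamma integral of shape 3/4. Relative to 2 / a the latter
  contributes Gamma (3/4) / pi^(1/4) times \<open>lyap_w x\<close>, and the quotient is at most
  19/20.\<close>

lemma nn_integral_lyap_u:
  "(\<integral>\<^sup>+u. indicator {0<..} u * ennreal (lyap_u u * exp (- ((1 + x\<^sup>2) / 2 * u))) \<partial>lborel)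
    \<le> ennreal ((1 + 19/20 * lyap_w x) * (2 / (1 + x\<^sup>2)))"
proof -
  define a where "a = 1 + x\<^sup>2"
  have a: "0 < a" by (simp add: a_def add_pos_nonneg)
  define m where "m = sqrt (sqrt (2 / pi))"
  have m: "0 < m" by (simp add: m_def)
  have root: "sqrt (sqrt t) = t powr (1/4)" if "0 \<le> t" for t :: real
    using that by (simp add: powr_half_sqrt[symmetric] powr_powr)
  have split: "lyap_u u = 1 + m * u powr (3/4 - 1)" if "0 < u" for u
  proof -
    have "sqrt (sqrt (2 / (pi * u))) = m * (1 / sqrt (sqrt u))"
      by (simp add: m_def real_sqrt_divide real_sqrt_mult)
    also have "1 / sqrt (sqrt u) = u powr (3/4 - 1)"
      using that by (simp add: root powr_minus_divide)
    finally show ?thesis by (simp add: lyap_u_def)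
  qed
  have "(\<integral>\<^sup>+u. indicator {0<..} u * ennreal (lyap_u u * exp (- (a / 2 * u))) \<partial>lborel)
      = (\<integral>\<^sup>+u. indicator {0<..} u * ennreal (exp (- (a / 2 * u)))
          + ennreal m * (indicator {0<..} u * ennreal (u powr (3/4 - 1) * exp (- (a / 2 * u)))) \<partial>lborel)"
    using m by (intro nn_integral_cong)
      (auto simp: indicator_def split distrib_right ennreal_mult[symmetric] mult.assoc)
  also have "\<dots> = ennreal (1 / (a / 2)) + ennreal m * ennreal (Gamma (3/4) / (a / 2) powr (3/4))"
    using nn_integral_exponential[of "a / 2"] nn_integral_Gamma[of "3/4" "a / 2"] a
    by (subst nn_integral_add) (auto simp: nn_integral_cmult)
  also have "\<dots> = ennreal (2 / a + m * (Gamma (3/4) / (a / 2) powr (3/4)))"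
    using a m by (simp add: ennreal_mult[symmetric] ennreal_plus[symmetric] less_imp_le del: ennreal_plus)
  also have "\<dots> \<le> ennreal ((1 + 19/20 * lyap_w x) * (2 / a))"
  proof (rule ennreal_leI)
    have "(a / 2) powr (3/4) = (a / 2) / sqrt (sqrt (a / 2))"
      using a powr_diff[of "a / 2" 1 "1/4"] by (simp add: root)
    then have "m * (Gamma (3/4) / (a / 2) powr (3/4)) = Gamma (3/4) / sqrt (sqrt pi) * lyap_w x * (2 / a)"
      using a by (simp add: m_def lyap_w_def a_def[symmetric] real_sqrt_divide field_simps)
    also have "\<dots> \<le> 19/20 * lyap_w x * (2 / a)"
      using a Gamma_three_quarters_le lyap_w_ge_1[of x]
      by (intro mult_right_mono) (auto simp: pos_divide_le_eq)
    finally show "2 / a + m * (Gamma (3/4) / (a / 2) powr (3/4)) \<le> (1 + 19/20 * lyap_w x) * (2 / a)"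
      by (simp add: algebra_simps)
  qed
  finally show ?thesis by (simp add: a_def)
qed

subsection \<open>The posterior measure\<close>

lemma borel_measurable_fst_snd [measurable (raw)]:
  fixes f :: "'c \<Rightarrow> 'a::topological_space \<times> 'b::topological_space"
  assumes "f \<in> borel_measurable M"
  shows "(\<lambda>x. fst (f x)) \<in> borel_measurable M" "(\<lambda>x. snd (f x)) \<in> borel_measurable M"
  by (rule borel_measurable_continuous_on[OF _ assms], intro continuous_intros)+

lemma nn_integral_lborel_fst:
  fixes f :: "'a::euclidean_space \<times> 'b::euclidean_space \<Rightarrow> ennreal"
  assumes "f \<in> borel_measurable borel"
  shows "(\<integral>\<^sup>+x. f x \<partial>lborel) = (\<integral>\<^sup>+a. \<integral>\<^sup>+b. f (a, b) \<partial>lborel \<partial>lborel)"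
proof -
  have "f \<in> borel_measurable (lborel \<Otimes>\<^sub>M lborel)" using assms by (simp add: lborel_prod)
  then show ?thesis unfolding lborel_prod[symmetric] by (rule lborel.nn_integral_fst[symmetric])
qed

lemma nn_integral_lborel_snd:
  fixes f :: "'a::euclidean_space \<times> 'b::euclidean_space \<Rightarrow> ennreal"
  assumes "f \<in> borel_measurable borel"
  shows "(\<integral>\<^sup>+x. f x \<partial>lborel) = (\<integral>\<^sup>+b. \<integral>\<^sup>+a. f (a, b) \<partial>lborel \<partial>lborel)"
proof -
  have "f \<in> borel_measurable (lborel \<Otimes>\<^sub>M lborel)" using assms by (simp add: lborel_prod)
  then show ?thesis unfolding lborel_prod[symmetric] by (rule lborel_pair.nn_integral_snd[symmetric])
qed

section \<open>Factors and total mass of the posterior density\<close>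

text \<open>The factor contributed by W = V + N2, at q = (v, w).\<close>

definition noise :: "real \<times> real \<Rightarrow> real" where
  "noise q = exp (- (1/2) * (snd q - fst q)\<^sup>2)"

text \<open>The likelihood of y given u and w is proportional to sqrt u times a Gaussian factor; the
  root cancels against u^(-1/2) in the Gamma prior, which leaves a pure exponential in u.\<close>

definition precision :: "real \<Rightarrow> real \<Rightarrow> real \<Rightarrow> real" where
  "precision y u w = exp (- (1/2) * (1 + (y - w)\<^sup>2) * u)"

lemma noise_measurable [measurable]: "noise \<in> borel_measurable borel"
  unfolding noise_def[abs_def] by measurable

lemma precision_measurable [measurable]:
  "f \<in> borel_measurable M \<Longrightarrow> g \<in> borel_measurable M \<Longrightarrow> (\<lambda>x. precision y (f x) (g x)) \<in> borel_measurable M"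
  unfolding precision_def by measurable

lemma noise_nonneg [simp]: "0 \<le> noise q" and precision_nonneg [simp]: "0 \<le> precision y u w"
  by (simp_all add: noise_def precision_def)

lemma ennreal_posterior_kernel:
  "ennreal (posterior_kernel y (u, q)) = indicator {0<..} u * (ennreal (precision y u (snd q)) * ennreal (noise q))"
  by (cases q) (simp add: posterior_kernel_def noise_def precision_def indicator_def ennreal_mult)

lemma posterior_kernel_measurable [measurable]: "(\<lambda>x. ennreal (posterior_kernel y x)) \<in> borel_measurable borel"
proof -
  have "(\<lambda>x. ennreal (posterior_kernel y x)) = (\<lambda>x. indicator {0<..} (fst x) * (ennreal (precision y (fst x) (snd (snd x))) * ennreal (noise (snd x))))"
    using ennreal_posterior_kernel[of y "fst x" "snd x" for x] by (auto simp: fun_eq_iff)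
  also have "\<dots> \<in> borel_measurable borel" by measurable
  finally show ?thesis .
qed

text \<open>For fixed w the noise is a Gaussian in v of mass sqrt (2 pi), so v integrates
  out.\<close>

lemma nn_integral_noise:
  assumes [measurable]: "\<beta> \<in> borel_measurable borel"
  shows "(\<integral>\<^sup>+q. \<beta> (snd q) * ennreal (noise q) \<partial>lborel) = ennreal (sqrt (2 * pi)) * (\<integral>\<^sup>+w. \<beta> w \<partial>lborel)"
proof -
  have "(\<integral>\<^sup>+q. \<beta> (snd q) * ennreal (noise q) \<partial>lborel)
    = (\<integral>\<^sup>+w. \<integral>\<^sup>+v. \<beta> w * ennreal (noise (v, w)) \<partial>lborel \<partial>lborel)"
    by (simp add: nn_integral_lborel_snd)
  also have "\<dots> = (\<integral>\<^sup>+w. \<beta> w * ennreal (sqrt (2 * pi)) \<partial>lborel)"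
  proof (rule nn_integral_cong)
    fix w :: real
    have [measurable]: "(\<lambda>v. noise (v, w)) \<in> borel_measurable borel" unfolding noise_def by measurable
    have "(\<integral>\<^sup>+v. ennreal (noise (v, w)) \<partial>lborel) = ennreal (sqrt (2 * pi))"
      using nn_integral_gaussian[of 1 w] by (simp add: noise_def power2_commute)
    then show "(\<integral>\<^sup>+v. \<beta> w * ennreal (noise (v, w)) \<partial>lborel) = \<beta> w * ennreal (sqrt (2 * pi))"
      by (simp add: nn_integral_cmult)
  qed
  finally show ?thesis by (simp add: nn_integral_multc mult.commute)
qed

lemma precision_eq: "precision y u w = exp (- (u / 2)) * exp (- (u * (w - y)\<^sup>2 / 2))"
  unfolding precision_def exp_add[symmetric] by (simp add: power2_commute algebra_simps)

text \<open>With v and w integrated out, u keeps the Gamma(1/2, 1/2) shape of its prior: the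
  Gaussian mass sqrt (2 pi / u) in w restores the factor u^(-1/2).\<close>

lemma nn_integral_precision_noise:
  assumes u: "0 < u"
  shows "(\<integral>\<^sup>+q. ennreal (precision y u (snd q)) * ennreal (noise q) \<partial>lborel)
    = ennreal (2 * pi * (u powr (1/2 - 1) * exp (- (1/2 * u))))"
proof -
  have "(\<integral>\<^sup>+q. ennreal (precision y u (snd q)) * ennreal (noise q) \<partial>lborel)
      = ennreal (sqrt (2 * pi)) * (\<integral>\<^sup>+w. ennreal (exp (- (u / 2))) * ennreal (exp (- (u * (w - y)\<^sup>2 / 2))) \<partial>lborel)"
    by (subst nn_integral_noise) (auto simp: precision_eq ennreal_mult)
  also have "\<dots> = ennreal (sqrt (2 * pi)) * (ennreal (exp (- (u / 2))) * ennreal (sqrt (2 * pi / u)))"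
    using u by (simp add: nn_integral_cmult nn_integral_gaussian)
  also have "\<dots> = ennreal (sqrt (2 * pi) * (exp (- (u / 2)) * sqrt (2 * pi / u)))"
    using u by (simp add: ennreal_mult[symmetric])
  also have "sqrt (2 * pi) * (exp (- (u / 2)) * sqrt (2 * pi / u)) = 2 * pi * (u powr (1/2 - 1) * exp (- (1/2 * u)))"
  proof -
    have "sqrt (2 * pi) * sqrt (2 * pi / u) = 2 * pi / sqrt u" by (simp add: real_sqrt_divide)
    moreover have "u powr (1/2 - 1) = 1 / sqrt u" using u by (simp add: powr_minus_divide powr_half_sqrt)
    ultimately show ?thesis
      by (simp only: mult.left_commute[of "sqrt (2 * pi)" "exp _"]) simp
  qed
  finally show ?thesis .
qed

text \<open>Makes the division in \<open>posterior\<close> a genuine normalisation; the mass is that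
  of the Gamma shaped marginal of u.\<close>

lemma posterior_kernel_mass: "\<exists>z>0. (\<integral>\<^sup>+x. ennreal (posterior_kernel y x) \<partial>lborel) = ennreal z"
proof (intro exI conjI)
  have "(\<integral>\<^sup>+x. ennreal (posterior_kernel y x) \<partial>lborel)
      = (\<integral>\<^sup>+u. \<integral>\<^sup>+q. indicator {0<..} u * (ennreal (precision y u (snd q)) * ennreal (noise q)) \<partial>lborel \<partial>lborel)"
    by (simp add: nn_integral_lborel_fst ennreal_posterior_kernel)
  also have "\<dots> = (\<integral>\<^sup>+u. ennreal (2 * pi) * (indicator {0<..} u * ennreal (u powr (1/2 - 1) * exp (- (1/2 * u)))) \<partial>lborel)"
    by (intro nn_integral_cong) (auto simp: indicator_def nn_integral_precision_noise ennreal_mult)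
  also have "\<dots> = ennreal (2 * pi) * ennreal (Gamma (1/2) / (1/2) powr (1/2))"
    using nn_integral_Gamma[of "1/2" "1/2"] by (subst nn_integral_cmult) auto
  finally show "(\<integral>\<^sup>+x. ennreal (posterior_kernel y x) \<partial>lborel) = ennreal (2 * pi * (Gamma (1/2) / (1/2) powr (1/2)))"
    using Gamma_real_pos[of "1/2"] by (simp add: ennreal_mult[symmetric])
  show "0 < 2 * pi * (Gamma (1/2) / (1/2 :: real) powr (1/2))"
    using Gamma_real_pos[of "1/2"] by simp
qed

lemma sets_posterior [measurable_cong]: "sets (posterior y) = sets borel"
  by (simp add: posterior_def)

lemma space_posterior [simp]: "space (posterior y) = UNIV"
  by (simp add: posterior_def)

lemma nn_integral_posterior:
  assumes [measurable]: "f \<in> borel_measurable borel"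
  shows "(\<integral>\<^sup>+x. f x \<partial>posterior y)
    = (\<integral>\<^sup>+x. ennreal (posterior_kernel y x) * f x \<partial>lborel) / (\<integral>\<^sup>+x. ennreal (posterior_kernel y x) \<partial>lborel)"
proof -
  let ?Z = "\<integral>\<^sup>+x. ennreal (posterior_kernel y x) \<partial>lborel"
  have "(\<integral>\<^sup>+x. f x \<partial>posterior y) = (\<integral>\<^sup>+x. ennreal (posterior_kernel y x) / ?Z * f x \<partial>lborel)"
    unfolding posterior_def by (rule nn_integral_density) measurable
  also have "\<dots> = (\<integral>\<^sup>+x. inverse ?Z * (ennreal (posterior_kernel y x) * f x) \<partial>lborel)"
    by (simp add: divide_ennreal_def mult_ac)
  also have "\<dots> = inverse ?Z * (\<integral>\<^sup>+x. ennreal (posterior_kernel y x) * f x \<partial>lborel)"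
    by (rule nn_integral_cmult) measurable
  finally show ?thesis by (simp add: divide_ennreal_def mult.commute)
qed

lemma prob_space_posterior: "prob_space (posterior y)"
proof
  obtain z where z: "0 < z" "(\<integral>\<^sup>+x. ennreal (posterior_kernel y x) \<partial>lborel) = ennreal z"
    using posterior_kernel_mass by blast
  have "emeasure (posterior y) (space (posterior y)) = (\<integral>\<^sup>+x. 1 \<partial>posterior y)" by simp
  also have "\<dots> = 1" by (subst nn_integral_posterior) (use z in \<open>auto simp: divide_ennreal\<close>)
  finally show "emeasure (posterior y) (space (posterior y)) = 1" .
qed

text \<open>The kernel is strictly positive exactly where u > 0, so within that half-space posterior
  and Lebesgue null sets coincide.\<close>

lemma AE_posterior:
  "(AE x in posterior y. P x) \<longleftrightarrow> (AE x in lborel. 0 < fst x \<longrightarrow> P x)"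
proof -
  obtain z where z: "0 < z" "(\<integral>\<^sup>+x. ennreal (posterior_kernel y x) \<partial>lborel) = ennreal z"
    using posterior_kernel_mass by blast
  have "0 < ennreal (posterior_kernel y x) / ennreal z \<longleftrightarrow> 0 < fst x" for x
    using z(1) by (cases x) (auto simp: posterior_kernel_def divide_ennreal)
  then show ?thesis unfolding posterior_def z(2) by (subst AE_density) auto
qed

section \<open>Drift inequalities for the Lyapunov functions\<close>

text \<open>This is E[B | u] \<le> A, tested against an arbitrary nonnegative weight
  \<open>\<alpha>\<close> of u. Tonelli's theorem thereby replaces conditional expectations: (v, w)
  is integrated first at fixed u.\<close>

lemma nn_integral_kernel_lyap_w:
  assumes [measurable]: "\<alpha> \<in> borel_measurable borel"
  shows "(\<integral>\<^sup>+x. ennreal (posterior_kernel y x) * (\<alpha> (fst x) * ennreal (lyap_w (snd (snd x) - y))) \<partial>lborel)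
    \<le> (\<integral>\<^sup>+x. ennreal (posterior_kernel y x) * (\<alpha> (fst x) * ennreal (lyap_u (fst x))) \<partial>lborel)"
proof -
  have inner: "(\<integral>\<^sup>+q. ennreal (lyap_w (snd q - y)) * (ennreal (precision y u (snd q)) * ennreal (noise q)) \<partial>lborel)
      \<le> ennreal (lyap_u u) * (\<integral>\<^sup>+q. ennreal (precision y u (snd q)) * ennreal (noise q) \<partial>lborel)"
    if u: "0 < u" for u
  proof -
    have nn: "0 \<le> lyap_w x" for x using lyap_w_ge_1[of x] by simp
    have "(\<integral>\<^sup>+q. ennreal (lyap_w (snd q - y)) * (ennreal (precision y u (snd q)) * ennreal (noise q)) \<partial>lborel)
        = ennreal (sqrt (2 * pi)) * (\<integral>\<^sup>+w. ennreal (lyap_w (w - y)) * ennreal (precision y u w) \<partial>lborel)"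
      by (subst nn_integral_noise[symmetric]) (auto simp: mult.assoc)
    also have "(\<integral>\<^sup>+w. ennreal (lyap_w (w - y)) * ennreal (precision y u w) \<partial>lborel)
        = ennreal (exp (- (u / 2))) * (\<integral>\<^sup>+w. ennreal (lyap_w (w - y) * exp (- (u * (w - y)\<^sup>2 / 2))) \<partial>lborel)"
      by (subst nn_integral_cmult[symmetric]) (auto simp: precision_eq ennreal_mult nn mult_ac)
    also have "\<dots> \<le> ennreal (exp (- (u / 2))) * ennreal (lyap_u u * sqrt (2 * pi / u))"
      by (rule mult_left_mono[OF nn_integral_lyap_w[OF u]]) simp
    also have "ennreal (sqrt (2 * pi)) * \<dots> = ennreal (lyap_u u) *
        (ennreal (sqrt (2 * pi)) * (ennreal (exp (- (u / 2))) * ennreal (sqrt (2 * pi / u))))"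
      using lyap_u_ge_1[OF u] u by (simp add: ennreal_mult mult_ac)
    also have "ennreal (sqrt (2 * pi)) * (ennreal (exp (- (u / 2))) * ennreal (sqrt (2 * pi / u)))
        = (\<integral>\<^sup>+q. ennreal (precision y u (snd q)) * ennreal (noise q) \<partial>lborel)"
      using u by (subst nn_integral_noise)
        (auto simp: precision_eq ennreal_mult nn_integral_cmult nn_integral_gaussian)
    finally show ?thesis by (simp add: mult_left_mono)
  qed
  have "(\<integral>\<^sup>+x. ennreal (posterior_kernel y x) * (\<alpha> (fst x) * ennreal (lyap_w (snd (snd x) - y))) \<partial>lborel)
      = (\<integral>\<^sup>+u. \<integral>\<^sup>+q. indicator {0<..} u * \<alpha> u * (ennreal (lyap_w (snd q - y)) *
          (ennreal (precision y u (snd q)) * ennreal (noise q))) \<partial>lborel \<partial>lborel)"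
    by (subst nn_integral_lborel_fst, measurable) (simp add: ennreal_posterior_kernel mult_ac)
  also have "\<dots> = (\<integral>\<^sup>+u. indicator {0<..} u * \<alpha> u * (\<integral>\<^sup>+q. ennreal (lyap_w (snd q - y)) *
          (ennreal (precision y u (snd q)) * ennreal (noise q)) \<partial>lborel) \<partial>lborel)"
    by (subst nn_integral_cmult) auto
  also have "\<dots> \<le> (\<integral>\<^sup>+u. indicator {0<..} u * \<alpha> u * (ennreal (lyap_u u) *
          (\<integral>\<^sup>+q. ennreal (precision y u (snd q)) * ennreal (noise q) \<partial>lborel)) \<partial>lborel)"
    by (intro nn_integral_mono) (auto simp: indicator_def intro!: mult_left_mono inner)
  also have "\<dots> = (\<integral>\<^sup>+u. \<integral>\<^sup>+q. indicator {0<..} u * \<alpha> u * ennreal (lyap_u u) *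
          (ennreal (precision y u (snd q)) * ennreal (noise q)) \<partial>lborel \<partial>lborel)"
    by (subst nn_integral_cmult) (auto simp: mult.assoc)
  also have "\<dots> = (\<integral>\<^sup>+x. ennreal (posterior_kernel y x) * (\<alpha> (fst x) * ennreal (lyap_u (fst x))) \<partial>lborel)"
    by (subst nn_integral_lborel_fst, measurable) (simp add: ennreal_posterior_kernel mult_ac)
  finally show ?thesis .
qed

lemma nn_integral_precision:
  "(\<integral>\<^sup>+u. indicator {0<..} u * ennreal (precision y u w) \<partial>lborel) = ennreal (2 / (1 + (w - y)\<^sup>2))"
  using nn_integral_exponential[of "(1 + (w - y)\<^sup>2) / 2"]
  by (simp add: precision_def power2_commute[of y] add_pos_nonneg)

text \<open>The companion bound E[A | v, w] \<le> 1 + 19/20 B, tested against a weight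
  \<open>\<beta>\<close> of (v, w). At fixed (v, w) the law of u is exponential with rate (1 + (w -
  y)^2) / 2.\<close>

lemma nn_integral_kernel_lyap_u:
  assumes [measurable]: "\<beta> \<in> borel_measurable borel"
  shows "(\<integral>\<^sup>+x. ennreal (posterior_kernel y x) * (\<beta> (snd x) * ennreal (lyap_u (fst x))) \<partial>lborel)
    \<le> (\<integral>\<^sup>+x. ennreal (posterior_kernel y x) * (\<beta> (snd x) * ennreal (1 + 19/20 * lyap_w (snd (snd x) - y))) \<partial>lborel)"
proof -
  have inner: "(\<integral>\<^sup>+u. indicator {0<..} u * (ennreal (precision y u w) * ennreal (lyap_u u)) \<partial>lborel)
      \<le> ennreal (1 + 19/20 * lyap_w (w - y)) * (\<integral>\<^sup>+u. indicator {0<..} u * ennreal (precision y u w) \<partial>lborel)" for w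
  proof -
    have "(\<integral>\<^sup>+u. indicator {0<..} u * (ennreal (precision y u w) * ennreal (lyap_u u)) \<partial>lborel)
      = (\<integral>\<^sup>+u. indicator {0<..} u * ennreal (lyap_u u * exp (- ((1 + (w - y)\<^sup>2) / 2 * u))) \<partial>lborel)"
      using lyap_u_ge_1 by (intro nn_integral_cong)
        (auto simp: indicator_def precision_def power2_commute[of y] ennreal_mult'' mult_ac)
    also have "\<dots> \<le> ennreal ((1 + 19/20 * lyap_w (w - y)) * (2 / (1 + (w - y)\<^sup>2)))" by (rule nn_integral_lyap_u)
    also have "\<dots> = ennreal (1 + 19/20 * lyap_w (w - y)) * ennreal (2 / (1 + (w - y)\<^sup>2))"
      using lyap_w_ge_1[of "w - y"] by (intro ennreal_mult) (auto simp: add_pos_nonneg)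
    finally show ?thesis by (simp only: nn_integral_precision)
  qed
  have "(\<integral>\<^sup>+x. ennreal (posterior_kernel y x) * (\<beta> (snd x) * ennreal (lyap_u (fst x))) \<partial>lborel)
      = (\<integral>\<^sup>+q. \<integral>\<^sup>+u. \<beta> q * ennreal (noise q) *
          (indicator {0<..} u * (ennreal (precision y u (snd q)) * ennreal (lyap_u u))) \<partial>lborel \<partial>lborel)"
    by (subst nn_integral_lborel_snd, measurable) (simp add: ennreal_posterior_kernel mult_ac)
  also have "\<dots> = (\<integral>\<^sup>+q. \<beta> q * ennreal (noise q) *
      (\<integral>\<^sup>+u. indicator {0<..} u * (ennreal (precision y u (snd q)) * ennreal (lyap_u u)) \<partial>lborel) \<partial>lborel)"
    by (subst nn_integral_cmult) auto
  also have "\<dots> \<le> (\<integral>\<^sup>+q. \<beta> q * ennreal (noise q) * (ennreal (1 + 19/20 * lyap_w (snd q - y)) *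
      (\<integral>\<^sup>+u. indicator {0<..} u * ennreal (precision y u (snd q)) \<partial>lborel)) \<partial>lborel)"
    by (intro nn_integral_mono mult_left_mono inner) simp
  also have "\<dots> = (\<integral>\<^sup>+q. \<integral>\<^sup>+u. \<beta> q * ennreal (noise q) * ennreal (1 + 19/20 * lyap_w (snd q - y)) *
      (indicator {0<..} u * ennreal (precision y u (snd q))) \<partial>lborel \<partial>lborel)"
    by (subst nn_integral_cmult) (auto simp: mult.assoc)
  also have "\<dots> = (\<integral>\<^sup>+x. ennreal (posterior_kernel y x) * (\<beta> (snd x) * ennreal (1 + 19/20 * lyap_w (snd (snd x) - y))) \<partial>lborel)"
    by (subst nn_integral_lborel_snd, measurable) (simp only: ennreal_posterior_kernel fst_conv snd_conv mult_ac)
  finally show ?thesis .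
qed

subsection \<open>Functions of some of the coordinates\<close>

text \<open>The preimage of the singleton of \<open>k x\<close> is a preimage under
  \<open>p\<close>, so it contains the whole fibre of x, in particular \<open>s (p x)\<close>.
  Conversely, invariance factors \<open>k\<close> as \<open>k \<circ> s\<close> after
  \<open>p\<close>.\<close>

lemma borel_measurable_vimage_algebra_iff:
  fixes k :: "'a::topological_space \<Rightarrow> 'c::t1_space" and p :: "'a \<Rightarrow> 'b::topological_space"
  assumes k: "k \<in> borel_measurable borel" and s: "s \<in> borel_measurable borel" and ps: "\<And>b. p (s b) = b"
  shows "k \<in> borel_measurable (vimage_algebra UNIV p borel) \<longleftrightarrow> (\<forall>x. k x = k (s (p x)))"
proof
  assume meas: "k \<in> borel_measurable (vimage_algebra UNIV p borel)"
  show "\<forall>x. k x = k (s (p x))"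
  proof
    fix x
    have "k -` {k x} \<inter> space (vimage_algebra UNIV p borel) \<in> sets (vimage_algebra UNIV p borel)"
      by (rule measurable_sets[OF meas]) simp
    then obtain A where "k -` {k x} = p -` A" by (auto simp: sets_vimage_algebra2)
    then have "x' \<in> k -` {k x} \<longleftrightarrow> p x' \<in> A" for x' by auto
    from this[of x] this[of "s (p x)"] show "k x = k (s (p x))" by (simp add: ps)
  qed
next
  assume eq: "\<forall>x. k x = k (s (p x))"
  have "p \<in> vimage_algebra UNIV p borel \<rightarrow>\<^sub>M borel" by (rule measurable_vimage_algebra1) simp
  then have "(\<lambda>x. (k \<circ> s) (p x)) \<in> borel_measurable (vimage_algebra UNIV p borel)"
    using measurable_comp[OF s k] by (rule measurable_compose)
  then show "k \<in> borel_measurable (vimage_algebra UNIV p borel)" using eq by simp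
qed

lemma subalgebra_vimage_borel:
  assumes "sets M = sets borel" "p \<in> borel_measurable borel"
  shows "subalgebra M (vimage_algebra UNIV p borel)"
proof -
  have "space M = UNIV" using sets_eq_imp_space_eq[OF assms(1)] by simp
  moreover have "p -` A \<in> sets borel" if "A \<in> sets borel" for A
    using measurable_sets[OF assms(2) that] by simp
  ultimately show ?thesis
    using assms(1) by (auto simp: subalgebra_def sets_vimage_algebra2)
qed

text \<open>Phrased through the sigma-algebra generated by \<open>p\<close> so that it matches the
  subspace in \<open>l2_projection_subalgebra\<close>.\<close>

definition L2_factor :: "'a measure \<Rightarrow> ('a \<Rightarrow> 'b::topological_space) \<Rightarrow> ('a \<Rightarrow> complex) set" where
  "L2_factor M p = {f \<in> L2 M. \<exists>g\<in>L2 M. g \<in> borel_measurable (vimage_algebra UNIV p borel) \<and> (AE x in M. f x = g x)}"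

lemma l2_projection_L2_factor:
  assumes "prob_space M" "sets M = sets borel" "p \<in> borel_measurable borel"
  shows "l2_projection M (L2_factor M p)"
  unfolding L2_factor_def
  by (rule prob_space.l2_projection_subalgebra[OF assms(1) subalgebra_vimage_borel[OF assms(2,3)]])

lemma (in finite_measure) const_in_L2_factor: "(\<lambda>_. c) \<in> L2_factor M p"
  unfolding L2_factor_def using L2_const[of c] by (auto intro!: bexI[of _ "\<lambda>_. c"])

lemma L2_borel_measurable: "g \<in> L2 M \<Longrightarrow> sets M = sets borel \<Longrightarrow> g \<in> borel_measurable borel"
  using L2_measurable[of g M] measurable_cong_sets[of M borel borel borel] by auto

text \<open>The witness is the representative evaluated along the section \<open>s\<close>, which is
  Borel as a composition.\<close>

lemma L2_factor_obtains:
  fixes M :: "'a::topological_space measure" and p :: "'a \<Rightarrow> 'b::topological_space"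
  assumes "f \<in> L2_factor M p" and M: "sets M = sets borel"
    and p: "p \<in> borel_measurable borel" "s \<in> borel_measurable borel" "\<And>b. p (s b) = b"
  obtains g where "g \<in> borel_measurable borel" "(\<lambda>x. g (p x)) \<in> L2 M" "AE x in M. f x = g (p x)"
proof -
  obtain k where k: "k \<in> L2 M" "k \<in> borel_measurable (vimage_algebra UNIV p borel)" "AE x in M. f x = k x"
    using assms(1) by (auto simp: L2_factor_def)
  have kb: "k \<in> borel_measurable borel" by (rule L2_borel_measurable[OF k(1) M])
  have factor: "k (s (p x)) = k x" for x
    using k(2) borel_measurable_vimage_algebra_iff[OF kb p(2,3)] by simp
  show ?thesis
    by (rule that[of "k \<circ> s"]) (use k measurable_comp[OF p(2) kb] in \<open>simp_all add: factor\<close>)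
qed

lemma E_U_eq_L2_factor:
  assumes M: "sets M = sets borel"
  shows "E_U M = L2_factor M snd"
proof -
  have "(\<forall>u u' v w. g (u, v, w) = g (u', v, w)) \<longleftrightarrow> g \<in> borel_measurable (vimage_algebra UNIV snd borel)"
    if "g \<in> L2 M" for g
  proof -
    have "g \<in> borel_measurable (vimage_algebra UNIV snd borel) \<longleftrightarrow> (\<forall>x. g x = g (0, snd x))"
      by (rule borel_measurable_vimage_algebra_iff[OF L2_borel_measurable[OF that M]]) auto
    also have "\<dots> \<longleftrightarrow> (\<forall>u u' v w. g (u, v, w) = g (u', v, w))" by (simp, metis)
    finally show ?thesis by simp
  qed
  then show ?thesis unfolding E_U_def L2_factor_def by blast
qed

lemma AE_lborel_pair:
  fixes P :: "'a::euclidean_space \<times> 'b::euclidean_space \<Rightarrow> bool"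
  assumes "AE x in lborel. P x"
  shows "AE a in lborel. AE b in lborel. P (a, b)"
  using assms unfolding lborel_prod[symmetric] by (rule lborel_pair.AE_pair)

lemma AE_lborel_pair_measure:
  fixes P :: "'a::euclidean_space \<times> 'b::euclidean_space \<Rightarrow> bool"
  assumes P: "Measurable.pred borel P" and "AE a in lborel. AE b in lborel. P (a, b)"
  shows "AE x in lborel. P x"
  unfolding lborel_prod[symmetric]
proof (rule lborel_pair.AE_pair_measure[OF _ assms(2)])
  have "{x \<in> space (lborel \<Otimes>\<^sub>M lborel). P x} = {x \<in> space borel. P x}" by (simp add: space_pair_measure)
  also have "\<dots> \<in> sets borel" using P by simp
  finally show "{x \<in> space (lborel \<Otimes>\<^sub>M lborel). P x} \<in> sets (lborel \<Otimes>\<^sub>M lborel)"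
    by (simp only: lborel_prod sets_lborel)
qed

text \<open>
  For almost every \<open>u\<close>, a function of \<open>w\<close> agrees almost everywhere with a function of \<open>v\<close>, hence with a
  constant; averaging over \<open>w \<in> [0, 1]\<close> recovers that constant as a measurable function of \<open>u\<close>.
\<close>

lemma E_V_Int_E_W_eq_L2_factor: "E_V (posterior y) \<inter> E_W (posterior y) = L2_factor (posterior y) fst"
proof (intro equalityI subsetI)
  fix f assume "f \<in> L2_factor (posterior y) fst"
  then obtain g where f: "f \<in> L2 (posterior y)" and g: "g \<in> L2 (posterior y)" "AE x in posterior y. f x = g x"
    and gF: "g \<in> borel_measurable (vimage_algebra UNIV fst borel)"
    by (auto simp: L2_factor_def)
  have "g \<in> borel_measurable (vimage_algebra UNIV fst borel) \<longleftrightarrow> (\<forall>x. g x = g (fst x, 0))"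
    by (rule borel_measurable_vimage_algebra_iff[OF L2_borel_measurable[OF g(1) sets_posterior]]) auto
  then have "g x = g (fst x, 0)" for x using gF by blast
  then have "g (u, q) = g (u, q')" for u q q' by (metis fst_conv)
  then show "f \<in> E_V (posterior y) \<inter> E_W (posterior y)"
    using f g unfolding E_V_def E_W_def by blast
next
  fix f assume "f \<in> E_V (posterior y) \<inter> E_W (posterior y)"
  then obtain g1 g2 where f: "f \<in> L2 (posterior y)" and g1: "g1 \<in> L2 (posterior y)"
    and inv1: "\<And>u v v' w. g1 (u, v, w) = g1 (u, v', w)" and eq1: "AE x in posterior y. f x = g1 x"
    and inv2: "\<And>u v w w'. g2 (u, v, w) = g2 (u, v, w')" and eq2: "AE x in posterior y. f x = g2 x"
    unfolding E_V_def E_W_def by blast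
  have [measurable]: "g1 \<in> borel_measurable borel" by (rule L2_borel_measurable[OF g1 sets_posterior])
  define h where "h u = (\<integral>w. indicator {0..1} w *\<^sub>R g1 (u, 0, w) \<partial>lborel)" for u
  have "(\<lambda>(u, w). indicator {0..1} w *\<^sub>R g1 (u, 0, w)) \<in> borel_measurable (borel \<Otimes>\<^sub>M lborel)"
    using measurable_compose[of "\<lambda>x::real \<times> real. (fst x, 0::real, snd x)" "borel \<Otimes>\<^sub>M lborel" borel g1 borel]
    by measurable
  then have h [measurable]: "h \<in> borel_measurable borel"
    unfolding h_def[abs_def] by (rule lborel.borel_measurable_lebesgue_integral)
  have "AE x in posterior y. g1 x = g2 x" using eq1 eq2 by eventually_elim simp
  then have "AE x in lborel. 0 < fst x \<longrightarrow> g1 x = g2 x" by (simp add: AE_posterior)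
  then have "AE u in lborel. AE q in lborel. 0 < u \<longrightarrow> g1 (u, q) = g2 (u, q)"
    using AE_lborel_pair by fastforce
  then have "AE u in lborel. AE q in lborel. 0 < u \<longrightarrow> g1 (u, q) = h u"
  proof eventually_elim
    case (elim u)
    show ?case
    proof (cases "0 < u")
      case True
      then have "AE q in lborel. g1 (u, q) = g2 (u, q)" using elim by simp
      then have "AE v in lborel. AE w in lborel. g1 (u, v, w) = g2 (u, v, w)" by (rule AE_lborel_pair)
      \<comment> \<open>Lebesgue measure is not zero, so what holds for almost every v holds for
        some v.\<close>
      moreover have "ae_filter (lborel :: real measure) \<noteq> bot"
        by (simp add: ae_filter_eq_bot_iff)
      ultimately obtain v where "AE w in lborel. g1 (u, v, w) = g2 (u, v, w)"
        using eventually_happens' by blast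
      \<comment> \<open>\<open>g1\<close> ignores v and \<open>g2\<close> ignores w, so fixing this
        v freezes their common value.\<close>
      then have const: "AE w in lborel. g1 (u, 0, w) = g2 (u, v, 0)"
        by eventually_elim (metis inv1 inv2)
      have "h u = (\<integral>w. indicator {0..1} w *\<^sub>R g2 (u, v, 0) \<partial>(lborel :: real measure))"
        unfolding h_def by (rule integral_cong_AE) (measurable, use const in \<open>eventually_elim, simp\<close>)
      \<comment> \<open>The averaging interval has length 1.\<close>
      also have "\<dots> = g2 (u, v, 0)" by simp
      finally have mean: "h u = g2 (u, v, 0)" .
      have "AE w in lborel. g1 (u, v', w) = h u" for v'
        using const by eventually_elim (metis inv1 mean)
      then have "AE v' in lborel. AE w in lborel. g1 (u, v', w) = h u" by simp
      then have "AE q in lborel. g1 (u, q) = h u"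
        by (intro AE_lborel_pair_measure) auto
      then show ?thesis by simp
    qed simp
  qed
  then have "AE x in lborel. 0 < fst x \<longrightarrow> g1 x = h (fst x)"
    by (intro AE_lborel_pair_measure) auto
  then have "AE x in posterior y. g1 x = h (fst x)" by (simp add: AE_posterior)
  with eq1 have eq: "AE x in posterior y. f x = h (fst x)" by eventually_elim simp
  have hm: "(\<lambda>x::real \<times> real \<times> real. h (fst x)) \<in> borel_measurable borel" by measurable
  then have "(\<lambda>x. h (fst x)) \<in> L2 (posterior y)"
    by (intro L2_cong_AE[OF f _ eq]) (simp add: measurable_cong_sets[OF sets_posterior refl])
  moreover have "(\<lambda>x. h (fst x)) \<in> borel_measurable (vimage_algebra UNIV (fst :: real \<times> real \<times> real \<Rightarrow> real) borel)"
    by (subst borel_measurable_vimage_algebra_iff[OF hm, of "\<lambda>u. (u, 0)"]) auto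
  ultimately show "f \<in> L2_factor (posterior y) fst"
    unfolding L2_factor_def using f eq by blast
qed

subsection \<open>Poincare inequality\<close>

text \<open>Otherwise \<open>J\<close> minus its mean over \<open>A\<close> would be positive on
  \<open>A\<close> with integral 0. The mean is then finite, being strictly below a value of
  \<open>J\<close>, so the subtraction of integrals is legitimate.\<close>

lemma exists_le_nn_integral:
  assumes [measurable]: "J \<in> borel_measurable M" "A \<in> sets M" and A: "emeasure M A = 1"
  shows "\<exists>a\<in>A. J a \<le> (\<integral>\<^sup>+x. indicator A x * J x \<partial>M)"
proof (rule ccontr)
  let ?D = "\<integral>\<^sup>+x. indicator A x * J x \<partial>M"
  assume "\<not> (\<exists>a\<in>A. J a \<le> ?D)"
  then have less: "?D < J a" if "a \<in> A" for a using that by auto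
  have "A \<noteq> {}" using A by auto
  then have fin: "?D \<noteq> \<infinity>" using less by fastforce
  have "(\<integral>\<^sup>+x. indicator A x * J x - indicator A x * ?D \<partial>M) = ?D - (\<integral>\<^sup>+x. indicator A x * ?D \<partial>M)"
  proof (rule nn_integral_diff)
    show "(\<integral>\<^sup>+x. indicator A x * ?D \<partial>M) \<noteq> \<infinity>" using A fin by (simp add: nn_integral_multc)
    show "AE x in M. indicator A x * ?D \<le> indicator A x * J x"
      using less by (auto simp: indicator_def less_imp_le)
  qed measurable
  also have "\<dots> = 0" using A fin by (simp add: nn_integral_multc)
  finally have "AE x in M. indicator A x * J x - indicator A x * ?D = 0"
    by (subst (asm) nn_integral_0_iff_AE) auto
  then have "AE x in M. x \<notin> A"
  proof eventually_elim
    case (elim x)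
    show ?case
    proof
      assume "x \<in> A"
      then have "J x - ?D = 0" using elim by simp
      then show False using less[OF \<open>x \<in> A\<close>] diff_gr0_ennreal by (metis less_irrefl)
    qed
  qed
  then have "emeasure M A = 0" using AE_iff_null_sets[OF assms(2)] by auto
  with A show False by simp
qed

text \<open>Both sides are divided by the same normalising constant.\<close>

lemma nn_integral_posterior_mono_kernel:
  assumes "f \<in> borel_measurable borel" "g \<in> borel_measurable borel"
    and "(\<integral>\<^sup>+x. ennreal (posterior_kernel y x) * f x \<partial>lborel) \<le> c * (\<integral>\<^sup>+x. ennreal (posterior_kernel y x) * g x \<partial>lborel)"
  shows "(\<integral>\<^sup>+x. f x \<partial>posterior y) \<le> c * (\<integral>\<^sup>+x. g x \<partial>posterior y)"
  unfolding nn_integral_posterior[OF assms(1)] nn_integral_posterior[OF assms(2)] ennreal_times_divide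
  by (rule divide_right_mono_ennreal[OF assms(3)])

text \<open>
  On the core \<open>{u \<in> [1, 2]} \<times> {1 + (w - y)\<^sup>2 \<le> R}\<close> the density is bounded below by a multiple of the noise
  density, so some \<open>u\<^sub>0 \<in> [1, 2]\<close> does no worse than average, and \<open>c = g u\<^sub>0\<close> is the required constant.
\<close>

lemma posterior_local_bound:
  assumes [measurable]: "g \<in> borel_measurable borel" "h \<in> borel_measurable borel"
  shows "\<exists>c. (\<integral>\<^sup>+x. indicator {w. 1 + (w - y)\<^sup>2 \<le> R} (snd (snd x)) * ennreal ((cmod (h (snd x) - c))\<^sup>2) \<partial>posterior y)
    \<le> ennreal (2 * exp R) * (\<integral>\<^sup>+x. ennreal ((cmod (g (fst x) - h (snd x)))\<^sup>2) \<partial>posterior y)"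
proof -
  let ?C = "indicator {w. 1 + (w - y)\<^sup>2 \<le> R} :: real \<Rightarrow> ennreal"
  \<comment> \<open>The error of the constant \<open>g u\<close> as an approximation of
    \<open>h\<close> on the core, weighted by the noise.\<close>
  define I where "I u = (\<integral>\<^sup>+q. ?C (snd q) * ennreal ((cmod (g u - h q))\<^sup>2) * ennreal (noise q) \<partial>lborel)" for u
  let ?D = "\<integral>\<^sup>+x. ennreal (posterior_kernel y x) * ennreal ((cmod (g (fst x) - h (snd x)))\<^sup>2) \<partial>lborel"
  have [measurable]: "I \<in> borel_measurable lborel"
    unfolding I_def[abs_def]
    by (rule lborel.borel_measurable_nn_integral) (simp add: borel_prod split_beta', measurable)
  obtain u0 where u0: "u0 \<in> {1..2}" "I u0 \<le> (\<integral>\<^sup>+u. indicator {1..2} u * I u \<partial>lborel)"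
    using exists_le_nn_integral[of I lborel "{1..2}"] by auto
  have "ennreal (exp (- R)) * (\<integral>\<^sup>+u. indicator {1..2} u * I u \<partial>lborel)
      = (\<integral>\<^sup>+u. \<integral>\<^sup>+q. ennreal (exp (- R)) * (indicator {1..2} u * (?C (snd q) * ennreal ((cmod (g u - h q))\<^sup>2) * ennreal (noise q))) \<partial>lborel \<partial>lborel)"
    unfolding I_def by (simp add: nn_integral_cmult)
  also have "\<dots> \<le> (\<integral>\<^sup>+u. \<integral>\<^sup>+q. ennreal (posterior_kernel y (u, q)) * ennreal ((cmod (g u - h q))\<^sup>2) \<partial>lborel \<partial>lborel)"
  proof (intro nn_integral_mono)
    fix u :: real and q :: "real \<times> real"
    show "ennreal (exp (- R)) * (indicator {1..2} u * (?C (snd q) * ennreal ((cmod (g u - h q))\<^sup>2) * ennreal (noise q)))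
      \<le> ennreal (posterior_kernel y (u, q)) * ennreal ((cmod (g u - h q))\<^sup>2)"
    proof (cases "u \<in> {1..2} \<and> 1 + (snd q - y)\<^sup>2 \<le> R")
      case True
      \<comment> \<open>Since u \<le> 2 offsets the 1/2 in the exponent, exp (- R) bounds the factor
        \<open>precision\<close> from below.\<close>
      have "(1 + (snd q - y)\<^sup>2) * (u / 2) \<le> R * 1"
        using True by (intro mult_mono) (auto intro: order_trans[of 0 "1 + (snd q - y)\<^sup>2"])
      then have "exp (- R) \<le> precision y u (snd q)"
        by (simp add: precision_def power2_commute[of y])
      then have "ennreal (exp (- R)) \<le> ennreal (precision y u (snd q))" by (rule ennreal_leI)
      then show ?thesis
        using True by (simp add: ennreal_posterior_kernel mult_right_mono mult_ac mult_left_mono)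
    qed auto
  qed
  also have "\<dots> = ?D" by (subst nn_integral_lborel_fst) auto
  finally have avg: "ennreal (exp (- R)) * (\<integral>\<^sup>+u. indicator {1..2} u * I u \<partial>lborel) \<le> ?D" .
  have "(\<integral>\<^sup>+x. ennreal (posterior_kernel y x) * (?C (snd (snd x)) * ennreal ((cmod (h (snd x) - g u0))\<^sup>2)) \<partial>lborel)
      = (\<integral>\<^sup>+q. \<integral>\<^sup>+u. ?C (snd q) * ennreal ((cmod (g u0 - h q))\<^sup>2) * ennreal (noise q) *
          (indicator {0<..} u * ennreal (precision y u (snd q))) \<partial>lborel \<partial>lborel)"
    by (subst nn_integral_lborel_snd, measurable)
      (simp only: ennreal_posterior_kernel fst_conv snd_conv mult_ac norm_minus_commute[of "h _"])
  also have "\<dots> = (\<integral>\<^sup>+q. ?C (snd q) * ennreal ((cmod (g u0 - h q))\<^sup>2) * ennreal (noise q) *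
          ennreal (2 / (1 + (snd q - y)\<^sup>2)) \<partial>lborel)"
    by (subst nn_integral_cmult) (auto simp: nn_integral_precision)
  \<comment> \<open>The integral 2 / (1 + (w - y)^2) over u is at most 2.\<close>
  also have "\<dots> \<le> (\<integral>\<^sup>+q. ?C (snd q) * ennreal ((cmod (g u0 - h q))\<^sup>2) * ennreal (noise q) * ennreal 2 \<partial>lborel)"
    by (intro nn_integral_mono mult_left_mono ennreal_leI) (auto simp: divide_le_eq add_pos_nonneg)
  also have "\<dots> = ennreal 2 * I u0"
    unfolding I_def by (subst nn_integral_multc) (auto simp: mult.commute)
  also have "\<dots> \<le> ennreal 2 * (\<integral>\<^sup>+u. indicator {1..2} u * I u \<partial>lborel)"
    by (rule mult_left_mono[OF u0(2)]) simp
  also have "\<dots> = ennreal (2 * exp R) * (ennreal (exp (- R)) * (\<integral>\<^sup>+u. indicator {1..2} u * I u \<partial>lborel))"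
  proof -
    have "ennreal (2 * exp R) * ennreal (exp (- R)) = ennreal 2"
      by (subst ennreal_mult[symmetric]) (simp_all add: exp_minus_inverse mult.assoc)
    then show ?thesis by (simp only: mult.assoc[symmetric])
  qed
  also have "\<dots> \<le> ennreal (2 * exp R) * ?D" by (rule mult_left_mono[OF avg]) simp
  finally show ?thesis
    by (intro exI[of _ "g u0"] nn_integral_posterior_mono_kernel) auto
qed

text \<open>In |z|^2 + |w|^2 = (|z| - |w|)^2 + 2 |z| |w| the square is bounded by the reverse
  triangle inequality and the product by the arithmetic-geometric mean inequality with weights b / a
  and a / b.\<close>

lemma weighted_norm_square_le:
  fixes z w :: complex
  assumes "0 < a" "0 < b"
  shows "(cmod z)\<^sup>2 + (cmod w)\<^sup>2 \<le> (cmod (z - w))\<^sup>2 + (cmod z)\<^sup>2 / a * b + (cmod w)\<^sup>2 / b * a"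
proof -
  have "(cmod z - cmod w)\<^sup>2 \<le> (cmod (z - w))\<^sup>2"
    using norm_triangle_ineq3[of z w] abs_le_square_iff[of "cmod z - cmod w" "cmod (z - w)"] by simp
  moreover have "2 * (cmod z * cmod w) \<le> (cmod z)\<^sup>2 / a * b + (cmod w)\<^sup>2 / b * a"
    using sum_squares_bound[of "cmod z * sqrt (b / a)" "cmod w * sqrt (a / b)"] assms
    by (simp add: power_mult_distrib real_sqrt_divide field_simps)
  ultimately show ?thesis by (simp add: power2_diff)
qed

text \<open>With a, b, d the squared norms of G, H, G - H and R = 40^4, the drift and core bounds
  give a + b \<le> d + a + 39/40 b + 2 exp R d. Hence b \<le> 40 (1 + 2 exp R) d, and a \<le> 2 d +
  2 b yields \<open>K\<close>.\<close>

lemma posterior_gap: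
  fixes y :: real
  defines "K \<equiv> 2 + 80 * (1 + 2 * exp (40 ^ 4))"
  assumes [measurable]: "g \<in> borel_measurable borel" "h \<in> borel_measurable borel"
    and g: "(\<lambda>x. g (fst x)) \<in> L2 (posterior y)" and h: "(\<lambda>x. h (snd x)) \<in> L2 (posterior y)"
  shows "\<exists>c. (l2_norm (posterior y) (\<lambda>x. g (fst x) - c))\<^sup>2
    \<le> K * (l2_norm (posterior y) (\<lambda>x. g (fst x) - h (snd x)))\<^sup>2"
proof -
  let ?\<pi> = "posterior y"
  interpret prob_space ?\<pi> by (rule prob_space_posterior)
  \<comment> \<open>Outside the core B is at least R^(1/4) = 40, so 1 / B + 19/20 is at most 39/40
    there.\<close>
  define R :: real where "R = 40 ^ 4"
  let ?C = "indicator {w. 1 + (w - y)\<^sup>2 \<le> R} :: real \<Rightarrow> ennreal"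
  obtain c where c: "(\<integral>\<^sup>+x. ?C (snd (snd x)) * ennreal ((cmod (h (snd x) - c))\<^sup>2) \<partial>?\<pi>)
    \<le> ennreal (2 * exp R) * (\<integral>\<^sup>+x. ennreal ((cmod (g (fst x) - h (snd x)))\<^sup>2) \<partial>?\<pi>)"
    using posterior_local_bound[OF assms(2,3)] by blast
  define G where "G u = g u - c" for u
  define H where "H q = h q - c" for q
  have [measurable]: "G \<in> borel_measurable borel" "H \<in> borel_measurable borel"
    unfolding G_def[abs_def] H_def[abs_def] by measurable
  have GL2: "(\<lambda>x. G (fst x)) \<in> L2 ?\<pi>" and HL2: "(\<lambda>x. H (snd x)) \<in> L2 ?\<pi>"
    unfolding G_def H_def by (intro L2_diff g h L2_const)+
  define a where "a = (l2_norm ?\<pi> (\<lambda>x. G (fst x)))\<^sup>2"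
  define b where "b = (l2_norm ?\<pi> (\<lambda>x. H (snd x)))\<^sup>2"
  define d where "d = (l2_norm ?\<pi> (\<lambda>x. G (fst x) - H (snd x)))\<^sup>2"
  have nn: "0 \<le> a" "0 \<le> b" "0 \<le> d" by (simp_all add: a_def b_def d_def)
  have inta: "(\<integral>\<^sup>+x. ennreal ((cmod (G (fst x)))\<^sup>2) \<partial>?\<pi>) = ennreal a"
    unfolding a_def by (rule nn_integral_L2[OF GL2])
  have intb: "(\<integral>\<^sup>+x. ennreal ((cmod (H (snd x)))\<^sup>2) \<partial>?\<pi>) = ennreal b"
    unfolding b_def by (rule nn_integral_L2[OF HL2])
  have intd: "(\<integral>\<^sup>+x. ennreal ((cmod (G (fst x) - H (snd x)))\<^sup>2) \<partial>?\<pi>) = ennreal d"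
    unfolding d_def by (rule nn_integral_L2[OF L2_diff[OF GL2 HL2]])
  have pos: "AE x in ?\<pi>. 0 < fst x" by (simp add: AE_posterior)
  let ?B = "\<lambda>x. lyap_w (snd (snd x) - y)" and ?A = "\<lambda>x :: real \<times> real \<times> real. lyap_u (fst x)"
  have B: "1 \<le> ?B x" for x by (rule lyap_w_ge_1)
  have "ennreal a + ennreal b = (\<integral>\<^sup>+x. ennreal ((cmod (G (fst x)))\<^sup>2) + ennreal ((cmod (H (snd x)))\<^sup>2) \<partial>?\<pi>)"
    by (subst nn_integral_add) (auto simp: inta intb)
  also have "\<dots> \<le> (\<integral>\<^sup>+x. ennreal ((cmod (G (fst x) - H (snd x)))\<^sup>2)
      + ennreal ((cmod (G (fst x)))\<^sup>2 / ?A x) * ennreal (?B x)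
      + ennreal ((cmod (H (snd x)))\<^sup>2 / ?B x) * ennreal (?A x) \<partial>?\<pi>)"
  proof (rule nn_integral_mono_AE, use pos in eventually_elim)
    case (elim x)
    have AB: "0 < ?A x" "0 < ?B x" using lyap_u_ge_1[OF elim] B[of x] by auto
    from weighted_norm_square_le[OF AB, of "G (fst x)" "H (snd x)"] AB show ?case
      by (simp add: ennreal_mult[symmetric] ennreal_plus[symmetric] del: ennreal_plus)
  qed
  also have "\<dots> = ennreal d + (\<integral>\<^sup>+x. ennreal ((cmod (G (fst x)))\<^sup>2 / ?A x) * ennreal (?B x) \<partial>?\<pi>)
      + (\<integral>\<^sup>+x. ennreal ((cmod (H (snd x)))\<^sup>2 / ?B x) * ennreal (?A x) \<partial>?\<pi>)"
    by (simp add: nn_integral_add intd)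
  also have "(\<integral>\<^sup>+x. ennreal ((cmod (G (fst x)))\<^sup>2 / ?A x) * ennreal (?B x) \<partial>?\<pi>)
      \<le> 1 * (\<integral>\<^sup>+x. ennreal ((cmod (G (fst x)))\<^sup>2 / ?A x) * ennreal (?A x) \<partial>?\<pi>)"
    using nn_integral_kernel_lyap_w[of "\<lambda>u. ennreal ((cmod (G u))\<^sup>2 / lyap_u u)" y]
    by (intro nn_integral_posterior_mono_kernel) auto
  also have "\<dots> = ennreal a"
    unfolding inta[symmetric] mult_1
  proof (rule nn_integral_cong_AE, use pos in eventually_elim)
    case (elim x)
    then show ?case using lyap_u_ge_1[OF elim] by (simp add: ennreal_mult[symmetric])
  qed
  also have "(\<integral>\<^sup>+x. ennreal ((cmod (H (snd x)))\<^sup>2 / ?B x) * ennreal (?A x) \<partial>?\<pi>)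
      \<le> 1 * (\<integral>\<^sup>+x. ennreal ((cmod (H (snd x)))\<^sup>2 / ?B x) * ennreal (1 + 19/20 * ?B x) \<partial>?\<pi>)"
    using nn_integral_kernel_lyap_u[of "\<lambda>q. ennreal ((cmod (H q))\<^sup>2 / lyap_w (snd q - y))" y]
    by (intro nn_integral_posterior_mono_kernel) auto
  also have "\<dots> \<le> (\<integral>\<^sup>+x. ennreal (39/40) * ennreal ((cmod (H (snd x)))\<^sup>2)
      + ?C (snd (snd x)) * ennreal ((cmod (H (snd x)))\<^sup>2) \<partial>?\<pi>)"
    unfolding mult_1
  proof (rule nn_integral_mono)
    fix x
    let ?N = "(cmod (H (snd x)))\<^sup>2"
    let ?i = "indicator {w. 1 + (w - y)\<^sup>2 \<le> R} (snd (snd x)) :: real"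
    have "1 / ?B x \<le> 1/40 + ?i"
    proof (cases "1 + (snd (snd x) - y)\<^sup>2 \<le> R")
      case True
      then show ?thesis using B[of x] by (simp add: divide_le_eq)
    next
      case False
      then have "sqrt (sqrt R) \<le> ?B x" unfolding lyap_w_def by (intro real_sqrt_le_mono) simp
      moreover have "sqrt (sqrt R) = 40"
      proof -
        have "R = (40\<^sup>2)\<^sup>2" by (simp add: R_def)
        then show ?thesis by (simp only: real_sqrt_abs) simp
      qed
      ultimately have "1 / ?B x \<le> 1 / 40" by (intro divide_left_mono) auto
      then show ?thesis by (simp add: add_increasing2)
    qed
    then have "?N * (1 / ?B x + 19/20) \<le> ?N * (39/40 + ?i)" by (intro mult_left_mono) auto
    moreover have "?N / ?B x * (1 + 19/20 * ?B x) = ?N * (1 / ?B x + 19/20)"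
      using B[of x] by (simp add: field_simps)
    ultimately have "ennreal (?N / ?B x * (1 + 19/20 * ?B x)) \<le> ennreal (39/40 * ?N + ?i * ?N)"
      by (intro ennreal_leI) (simp add: algebra_simps)
    moreover have "ennreal (?N / ?B x * (1 + 19/20 * ?B x)) = ennreal (?N / ?B x) * ennreal (1 + 19/20 * ?B x)"
      by (rule ennreal_mult) (use B[of x] in auto)
    moreover have "ennreal (39/40 * ?N + ?i * ?N) = ennreal (39/40 * ?N) + ennreal (?i * ?N)"
      by (rule ennreal_plus) auto
    moreover have "ennreal (39/40 * ?N) = ennreal (39/40) * ennreal ?N"
      by (rule ennreal_mult) auto
    moreover have "ennreal (?i * ?N) = ?C (snd (snd x)) * ennreal ?N"
      by (simp add: indicator_def)
    ultimately show "ennreal (?N / ?B x) * ennreal (1 + 19/20 * ?B x)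
        \<le> ennreal (39/40) * ennreal ?N + ?C (snd (snd x)) * ennreal ?N"
      by (simp only:)
  qed
  also have "\<dots> = ennreal (39/40) * ennreal b + (\<integral>\<^sup>+x. ?C (snd (snd x)) * ennreal ((cmod (H (snd x)))\<^sup>2) \<partial>?\<pi>)"
    by (subst nn_integral_add) (auto simp: nn_integral_cmult intb)
  also have "(\<integral>\<^sup>+x. ?C (snd (snd x)) * ennreal ((cmod (H (snd x)))\<^sup>2) \<partial>?\<pi>) \<le> ennreal (2 * exp R) * ennreal d"
    using c unfolding intd[symmetric] by (simp add: G_def H_def)
  finally have "ennreal a + ennreal b \<le> ennreal d + ennreal a
      + (ennreal (39/40) * ennreal b + ennreal (2 * exp R) * ennreal d)"
    by (auto intro: add_mono)
  \<comment> \<open>Back in the reals, where a is finite and cancels in the next step.\<close>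
  then have "a + b \<le> d + a + (39/40 * b + 2 * exp R * d)"
    using nn by (simp add: ennreal_mult[symmetric] ennreal_plus[symmetric] del: ennreal_plus)
  then have "b \<le> 40 * (1 + 2 * exp R) * d" by (simp add: algebra_simps)
  moreover have "a \<le> 2 * d + 2 * b"
    using l2_norm_add_square_le[OF L2_diff[OF GL2 HL2] HL2] by (simp add: a_def b_def d_def)
  ultimately have "a \<le> K * d" unfolding K_def R_def by (simp add: algebra_simps)
  then show ?thesis unfolding a_def d_def G_def H_def by (intro exI[of _ c]) simp
qed

theorem proposition5p2:
  fixes y :: real
  shows "l2_spectral_radius (posterior y)
           (\<lambda>f x. blocked_gibbs (posterior y) f x - mean_op (posterior y) f x) < 1"
proof -
  let ?\<pi> = "posterior y"
  interpret prob_space ?\<pi> by (rule prob_space_posterior)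
  have fst: "(fst :: real \<times> real \<times> real \<Rightarrow> real) \<in> borel_measurable borel"
    and snd: "(snd :: real \<times> real \<times> real \<Rightarrow> real \<times> real) \<in> borel_measurable borel" by measurable
  show ?thesis
    \<comment> \<open>The two subspaces become the functions of (v, w) and the functions of u, which
      factor through \<open>snd\<close> and \<open>fst\<close>.\<close>
    unfolding blocked_gibbs_def E_U_eq_L2_factor[OF sets_posterior] E_V_Int_E_W_eq_L2_factor
  proof (rule l2_spectral_radius_projections_less_1)
    show "l2_projection ?\<pi> (L2_factor ?\<pi> fst)" "l2_projection ?\<pi> (L2_factor ?\<pi> snd)"
      by (intro l2_projection_L2_factor prob_space_posterior sets_posterior fst snd)+
    have "1 < 2 + 80 * (1 + 2 * e)" if "0 < e" for e :: real using that by simp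
    then show "1 < 2 + 80 * (1 + 2 * exp (40 ^ 4 :: real))" using exp_gt_zero by blast
    fix f k assume f: "f \<in> L2_factor ?\<pi> fst" and k: "k \<in> L2_factor ?\<pi> snd"
    \<comment> \<open>Norms depend only on classes, so f and k may be replaced by Borel functions of
      u and of (v, w).\<close>
    obtain g where g: "g \<in> borel_measurable borel" "(\<lambda>x. g (fst x)) \<in> L2 ?\<pi>" "AE x in ?\<pi>. f x = g (fst x)"
      by (rule L2_factor_obtains[OF f sets_posterior fst, of "\<lambda>u. (u, 0)"]) auto
    obtain h where h: "h \<in> borel_measurable borel" "(\<lambda>x. h (snd x)) \<in> L2 ?\<pi>" "AE x in ?\<pi>. k x = h (snd x)"
      by (rule L2_factor_obtains[OF k sets_posterior snd, of "\<lambda>q. (0, q)"]) auto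
    have fk: "f \<in> L2 ?\<pi>" "k \<in> L2 ?\<pi>" using f k by (auto simp: L2_factor_def)
    have "l2_norm ?\<pi> (\<lambda>x. f x - c) = l2_norm ?\<pi> (\<lambda>x. g (fst x) - c)" for c
      by (rule l2_norm_cong_AE)
        (use g(3) L2_diff[OF fk(1) L2_const] L2_diff[OF g(2) L2_const] in \<open>auto dest: L2_measurable\<close>)
    moreover have "l2_norm ?\<pi> (\<lambda>x. f x - k x) = l2_norm ?\<pi> (\<lambda>x. g (fst x) - h (snd x))"
      by (rule l2_norm_cong_AE)
        (use g(3) h(3) L2_diff[OF fk] L2_diff[OF g(2) h(2)] in \<open>auto dest: L2_measurable\<close>)
    ultimately show "\<exists>c. (l2_norm ?\<pi> (\<lambda>x. f x - c))\<^sup>2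
        \<le> (2 + 80 * (1 + 2 * exp (40 ^ 4))) * (l2_norm ?\<pi> (\<lambda>x. f x - k x))\<^sup>2"
      using posterior_gap[OF g(1) h(1) g(2) h(2)] by simp
  qed (rule const_in_L2_factor)+
qed

end
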